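(* Let $n\ge1$ and $w\in B_n$, and let $\lambda(w)$ be the shape (a partition of $2n$) of the RSK insertion tableau of the sequence $w^0=(-w_n,\ldots,-w_1,w_1,\ldots,w_n)$ with respect to the order $-n<\cdots<-1<1<\cdots<n$. Then $w\in\mathrm{FC}(B_n)$ if and only if $\lambda(w)$ is admissible, i.e. \[ \lambda(w)\in\{(2n-k,k)\mid 0\le k\le n\}\cup\{(2n-2k,2k-1,1)\mid 1\le k\le\lfloor n/2\rfloor\}. \] Equivalently, $\mathrm{FC}(B_n)$ is the disjoint union of the two-sided combinatorial cells $\mathcal{C}_\lambda=\{w\in B_n\mid\lambda(w)=\lambda\}$ over the admissible shapes $\lambda$.
   Context: $B_n$ is the group of signed permutations $w=[w_1,\ldots,w_n]$ of $\{\pm1,\ldots,\pm n\}$ with Coxeter generators $s_0=[-1,2,\ldots,n]$ and $s_i=[1,\ldots,i-1,i+1,i,i+2,\ldots,n]$ ($1\le i\le n-1$). An element is fully commutative (FC) if any reduced expression can be obtained from any other using only commutation relations between commuting generators; $\mathrm{FC}(B_n)$ is the set of FC elements. RSK denotes the Robinson–Schensted row-insertion correspondence applied to a sequence of distinct totally ordered values. (The shape $\lambda(w)$ coincides with the common shape of the pair of domino tableaux assigned to $w$ by the Barbash–Vogan/Garfinkle domino insertion.) *)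

theory Defs
  imports Main
begin

text \<open>Signed permutations of {+-1..+-n} in one-line notation [w_1,...,w_n] as int lists.\<close>
definition signed_perm :: "nat \<Rightarrow> int list \<Rightarrow> bool" where
  "signed_perm n w \<longleftrightarrow> length w = n \<and> set (map abs w) = {1..int n}"

text \<open>Right multiplication by the Coxeter generator s_i, acting on one-line notation:
  s_0 negates the first entry, s_i (i>=1) swaps entries i and i+1 (1-indexed).\<close>
definition gen_act :: "nat \<Rightarrow> int list \<Rightarrow> int list" where
  "gen_act i w = (if i = 0 then w[0 := - (w ! 0)] else w[i - 1 := w ! i, i := w ! (i - 1)])"

definition word_eval :: "nat \<Rightarrow> nat list \<Rightarrow> int list" where
  "word_eval n ws = fold gen_act ws (map int [1..<n+1])"

definition is_word :: "nat \<Rightarrow> int list \<Rightarrow> nat list \<Rightarrow> bool" where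
  "is_word n w ws \<longleftrightarrow> set ws \<subseteq> {..<n} \<and> word_eval n ws = w"

definition coxeter_length :: "nat \<Rightarrow> int list \<Rightarrow> nat" where
  "coxeter_length n w = (LEAST k. \<exists>ws. is_word n w ws \<and> length ws = k)"

definition reduced_word :: "nat \<Rightarrow> int list \<Rightarrow> nat list \<Rightarrow> bool" where
  "reduced_word n w ws \<longleftrightarrow> is_word n w ws \<and> length ws = coxeter_length n w"

definition comm_step :: "nat list \<Rightarrow> nat list \<Rightarrow> bool" where
  "comm_step u v \<longleftrightarrow> (\<exists>xs ys a b. (a + 2 \<le> b \<or> b + 2 \<le> a) \<and>
      u = xs @ [a, b] @ ys \<and> v = xs @ [b, a] @ ys)"

definition fully_commutative :: "nat \<Rightarrow> int list \<Rightarrow> bool" where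
  "fully_commutative n w \<longleftrightarrow>
     (\<forall>u v. reduced_word n w u \<and> reduced_word n w v \<longrightarrow> comm_step\<^sup>*\<^sup>* u v)"

fun row_ins :: "int \<Rightarrow> int list \<Rightarrow> int list \<times> int option" where
  "row_ins x [] = ([x], None)"
| "row_ins x (y # ys) = (if x < y then (x # ys, Some y)
                         else (let (r, b) = row_ins x ys in (y # r, b)))"

fun tab_ins :: "int \<Rightarrow> int list list \<Rightarrow> int list list" where
  "tab_ins x [] = [[x]]"
| "tab_ins x (r # rs) = (case row_ins x r of
       (r', None) \<Rightarrow> r' # rs
     | (r', Some y) \<Rightarrow> r' # tab_ins y rs)"

definition rsk_P :: "int list \<Rightarrow> int list list" where
  "rsk_P xs = fold tab_ins xs []"

definition rsk_shape :: "int list \<Rightarrow> nat list" where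
  "rsk_shape xs = map length (rsk_P xs)"

definition w0_seq :: "int list \<Rightarrow> int list" where
  "w0_seq w = map uminus (rev w) @ w"

definition lam :: "int list \<Rightarrow> nat list" where
  "lam w = rsk_shape (w0_seq w)"

text \<open>Admissible shapes (partitions as weakly decreasing lists of positive parts).\<close>
definition admissible :: "nat \<Rightarrow> nat list \<Rightarrow> bool" where
  "admissible n l \<longleftrightarrow>
     (\<exists>k\<le>n. l = filter (\<lambda>x. 0 < x) [2*n - k, k]) \<or>
     (\<exists>k. 1 \<le> k \<and> k \<le> n div 2 \<and> l = [2*n - 2*k, 2*k - 1, 1])"

end

theory Submission
  imports Defs
begin

text \<open>
  Read \<open>w\<close> as an odd function on the positions \<open>\<plusminus>1, ..., \<plusminus>n\<close>. Both sides of the equivalence say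
  that \<open>w\<close> is not bad, where bad means that \<open>w\<^sup>0\<close> has a decreasing subsequence of length \<open>3\<close> at
  positions with distinct absolute values, or that \<open>0 > w\<^sub>j > w\<^sub>k\<close> for some \<open>0 < j < k\<close>.

  Badness is inherited upwards in the right weak order. Two non-commuting descents make \<open>w\<close> bad,
  so for \<open>w\<close> not bad any two reduced words are connected by commutations, by induction on the
  length; conversely a bad \<open>w\<close> has two adjacent descents, hence a reduced word with a long braid,
  or a descent that leads to a smaller bad element.

  On the tableau side, Greene's theorem for one and two increasing subsequences (proved through
  Knuth moves) gives \<open>\<lambda>\<^sub>1\<close> and \<open>\<lambda>\<^sub>1 + \<lambda>\<^sub>2\<close>. If \<open>w\<close> is bad, the symmetry of \<open>w\<^sup>0\<close> yields
  enough decreasing triples that no two increasing subsequences cover all but one entry. If not,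
  all decreasing triples of \<open>w\<^sup>0\<close> share the entry at a single position \<open>p\<close>; deleting it leaves a union
  of two increasing subsequences, so the third row has at most one box, and in case there is a
  third row a symmetrization argument shows that \<open>\<lambda>\<^sub>1\<close> is even.
\<close>

section \<open>Greene's theorem for one and two increasing subsequences\<close>

definition inc_on :: "int list \<Rightarrow> int set \<Rightarrow> bool" where
  "inc_on xs A \<longleftrightarrow> sorted_wrt (\<lambda>u v. u \<in> A \<longrightarrow> v \<in> A \<longrightarrow> u < v) xs"

text \<open>For a list with distinct entries a subsequence is determined by its set of values.
  Working with value sets makes moves that only reorder the list leave the candidate set unchanged
  in most cases.\<close>

definition chain :: "int list \<Rightarrow> int set \<Rightarrow> bool" where
  "chain xs A \<longleftrightarrow> A \<subseteq> set xs \<and> inc_on xs A"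

lemma inc_on_Nil [simp]: "inc_on [] A"
  by (simp add: inc_on_def)

lemma inc_on_Cons [simp]:
  "inc_on (x # xs) A \<longleftrightarrow> inc_on xs A \<and> (x \<in> A \<longrightarrow> (\<forall>v\<in>set xs \<inter> A. x < v))"
  by (auto simp: inc_on_def)

lemma inc_on_append [simp]:
  "inc_on (xs @ ys) A \<longleftrightarrow> inc_on xs A \<and> inc_on ys A \<and>
     (\<forall>u\<in>set xs \<inter> A. \<forall>v\<in>set ys \<inter> A. u < v)"
  by (auto simp: inc_on_def sorted_wrt_append)

lemma inc_on_cong: "A \<inter> set xs = A' \<inter> set xs \<Longrightarrow> inc_on xs A \<longleftrightarrow> inc_on xs A'"
  unfolding inc_on_def by (auto elim!: sorted_wrt_mono_rel[rotated])

lemma inc_on_mono: "inc_on xs A \<Longrightarrow> A' \<subseteq> A \<Longrightarrow> inc_on xs A'"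
  unfolding inc_on_def by (erule sorted_wrt_mono_rel[rotated]) blast

lemma chain_subset: "chain xs A \<Longrightarrow> A' \<subseteq> A \<Longrightarrow> chain xs A'"
  unfolding chain_def using inc_on_mono by blast

lemma finite_chain: "chain xs A \<Longrightarrow> finite A"
  unfolding chain_def using finite_subset by blast

text \<open>Allowing a second chain \<open>B\<close> but preserving \<open>B = {}\<close> transports the Greene invariants
  for one and for two increasing subsequences at the same time.\<close>

definition chains_le :: "int list \<Rightarrow> int list \<Rightarrow> bool" where
  "chains_le xs ys \<longleftrightarrow> (\<forall>A B. chain xs A \<longrightarrow> chain xs B \<longrightarrow>
     (\<exists>A' B'. chain ys A' \<and> chain ys B' \<and> card (A' \<union> B') = card (A \<union> B) \<and> (B = {} \<longrightarrow> B' = {})))"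

lemma chains_le_refl: "chains_le xs xs"
  unfolding chains_le_def by blast

lemma chains_le_trans: "chains_le xs ys \<Longrightarrow> chains_le ys zs \<Longrightarrow> chains_le xs zs"
  unfolding chains_le_def by (metis (no_types, lifting))

text \<open>No chain contains both entries of the descent \<open>c, a\<close>, so every chain
  survives the exchange unchanged.\<close>

lemma chains_le_transpose:
  assumes "a < c" shows "chains_le (x @ [c, a] @ y) (x @ [a, c] @ y)"
proof -
  have "chain (x @ [c, a] @ y) A \<Longrightarrow> chain (x @ [a, c] @ y) A" for A
    using assms by (auto simp: chain_def)
  then show ?thesis unfolding chains_le_def by blast
qed

text \<open>Removing \<open>A\<close> from the second chain keeps the union and makes the two chains
  disjoint. Then at most one of them contains both \<open>a\<close> and \<open>c\<close>, and by
  symmetry it may be taken to be the first. If the roles are exchanged, the second chain is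
  nonempty, so the clause on empty chains holds vacuously.\<close>

lemma chains_le_from_disjoint:
  assumes both: "\<And>A B. chain xs A \<Longrightarrow> chain xs B \<Longrightarrow> A \<inter> B = {} \<Longrightarrow> a \<in> A \<Longrightarrow> c \<in> A \<Longrightarrow>
     \<exists>A' B'. chain ys A' \<and> chain ys B' \<and> card (A' \<union> B') = card (A \<union> B) \<and> (B = {} \<longrightarrow> B' = {})"
   and same: "\<And>A. chain xs A \<Longrightarrow> \<not> (a \<in> A \<and> c \<in> A) \<Longrightarrow> chain ys A"
  shows "chains_le xs ys"
  unfolding chains_le_def
proof (intro allI impI)
  fix A B0 assume A: "chain xs A" and B0: "chain xs B0"
  define B where "B = B0 - A"
  have B: "chain xs B" using B0 chain_subset unfolding B_def by blast
  have un: "A \<union> B0 = A \<union> B" and dis: "A \<inter> B = {}" and e: "B0 = {} \<Longrightarrow> B = {}"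
    unfolding B_def by auto
  consider "a \<in> A" "c \<in> A" | "a \<in> B" "c \<in> B" | "\<not> (a \<in> A \<and> c \<in> A)" "\<not> (a \<in> B \<and> c \<in> B)" by blast
  then show "\<exists>A' B'. chain ys A' \<and> chain ys B' \<and> card (A' \<union> B') = card (A \<union> B0) \<and> (B0 = {} \<longrightarrow> B' = {})"
  proof cases
    case 1 then show ?thesis using both[OF A B dis] e unfolding un by blast
  next
    case 2
    then have "B0 \<noteq> {}" unfolding B_def by blast
    moreover have "B \<inter> A = {}" using dis by blast
    ultimately show ?thesis using both[OF B A _ 2] unfolding un by (metis Un_commute)
  next
    case 3 then show ?thesis using same A B e unfolding un by blast
  qed
qed

lemma card_exchange:
  assumes "finite S" "u \<in> S" "v \<notin> S" "T = insert v (S - {u})"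
  shows "card T = card S"
proof -
  have "card (insert v (S - {u})) = Suc (card (S - {u}))"
    using assms by simp
  then show ?thesis using assms by (metis card.remove)
qed

lemma chain_blockI:
  assumes "distinct (x @ z @ y)" "X \<subseteq> set x" "Z \<subseteq> set z" "Y \<subseteq> set y"
    "inc_on x X" "inc_on z Z" "inc_on y Y"
    "\<And>u v. u \<in> X \<Longrightarrow> v \<in> Z \<Longrightarrow> u < v" "\<And>u v. u \<in> Z \<Longrightarrow> v \<in> Y \<Longrightarrow> u < v"
    "\<And>u v. u \<in> X \<Longrightarrow> v \<in> Y \<Longrightarrow> u < v"
  shows "chain (x @ z @ y) (X \<union> Z \<union> Y)"
proof -
  let ?A = "X \<union> Z \<union> Y"
  have eq: "set x \<inter> ?A = X" "set z \<inter> ?A = Z" "set y \<inter> ?A = Y" using assms(1-4) by auto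
  have "inc_on x ?A" "inc_on z ?A" "inc_on y ?A"
    using assms(5-7) inc_on_cong[of ?A x X] inc_on_cong[of ?A z Z] inc_on_cong[of ?A y Y] eq
      assms(2-4) by (simp_all add: Int_absorb2 Int_commute)
  moreover have "set (z @ y) \<inter> ?A = Z \<union> Y" using eq by auto
  ultimately show ?thesis
    using assms(2-4,8-10) unfolding chain_def inc_on_append eq by auto
qed

text \<open>Only a chain \<open>A\<close> through both \<open>a\<close> and \<open>c\<close> is
  destroyed, and it cannot contain \<open>b\<close>. If \<open>b\<close> lies in neither chain, it
  takes the place of \<open>a\<close>. If \<open>b\<close> lies in \<open>B\<close>, the two chains
  exchange their tails: \<open>A\<close> up to \<open>a\<close> continues with \<open>B\<close>,
  while \<open>B\<close> up to \<open>b\<close> continues with \<open>c\<close> and the rest of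
  \<open>A\<close>; the union does not change.\<close>

lemma chains_le_bac:
  assumes d: "distinct (x @ [b, a, c] @ y)" and ab: "a < b" and bc: "b < c"
  shows "chains_le (x @ [b, a, c] @ y) (x @ [b, c, a] @ y)"
proof (rule chains_le_from_disjoint[where a = a and c = c])
  fix A assume "chain (x @ [b, a, c] @ y) A" "\<not> (a \<in> A \<and> c \<in> A)"
  then show "chain (x @ [b, c, a] @ y) A" unfolding chain_def by auto
next
  fix A B assume A: "chain (x @ [b, a, c] @ y) A" and B: "chain (x @ [b, a, c] @ y) B"
    and dis: "A \<inter> B = {}" and aA: "a \<in> A" and cA: "c \<in> A"
  have d': "distinct (x @ [b, c, a] @ y)" using d by auto
  have aB: "a \<notin> B" "c \<notin> B" using dis aA cA by auto
  have bA: "b \<notin> A" using A aA cA ab bc unfolding chain_def by auto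
  have fin: "finite A" "finite B" using A B finite_chain by auto
  have incA: "inc_on x (A \<inter> set x)" "inc_on y (A \<inter> set y)"
    and incB: "inc_on x (B \<inter> set x)" "inc_on y (B \<inter> set y)"
    using A B unfolding chain_def by (auto intro: inc_on_mono[OF _ Int_lower1])
  have Ax: "u < a" if "u \<in> A \<inter> set x" for u using A aA that unfolding chain_def by auto
  have Ay: "c < u" if "u \<in> A \<inter> set y" for u using A cA that unfolding chain_def by auto
  show "\<exists>A' B'. chain (x @ [b, c, a] @ y) A' \<and> chain (x @ [b, c, a] @ y) B' \<and>
     card (A' \<union> B') = card (A \<union> B) \<and> (B = {} \<longrightarrow> B' = {})"
  proof (cases "b \<in> B")
    case False
    define A' where "A' = (A \<inter> set x) \<union> {b, c} \<union> (A \<inter> set y)"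
    have A': "chain (x @ [b, c, a] @ y) A'"
    proof (unfold A'_def, rule chain_blockI[OF d'])
      show "u < v" if "u \<in> A \<inter> set x" "v \<in> {b, c}" for u v
        using Ax[OF that(1)] that(2) ab bc by auto
      show "u < v" if "u \<in> {b, c}" "v \<in> A \<inter> set y" for u v
        using Ay[OF that(2)] that(1) ab bc by auto
      show "u < v" if "u \<in> A \<inter> set x" "v \<in> A \<inter> set y" for u v
        using Ax[OF that(1)] Ay[OF that(2)] ab bc by auto
    qed (use incA ab bc in auto)
    have B': "chain (x @ [b, c, a] @ y) B" using B aB unfolding chain_def by auto
    have eq: "A' = insert b (A - {a})"
      using A bA aA cA d unfolding A'_def chain_def by auto
    have "card (A' \<union> B) = card (A \<union> B)"
      by (rule card_exchange[of _ a b]) (use fin aA cA aB bA False in \<open>auto simp: eq\<close>)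
    then show ?thesis using A' B' by blast
  next
    case True
    have Bx: "u < b" if "u \<in> B \<inter> set x" for u using B True that unfolding chain_def by auto
    have By: "b < u" if "u \<in> B \<inter> set y" for u using B True that unfolding chain_def by auto
    define A' where "A' = (A \<inter> set x) \<union> {a} \<union> (B \<inter> set y)"
    define B' where "B' = (B \<inter> set x) \<union> {b, c} \<union> (A \<inter> set y)"
    have A': "chain (x @ [b, c, a] @ y) A'"
    proof (unfold A'_def, rule chain_blockI[OF d'])
      show "u < v" if "u \<in> A \<inter> set x" "v \<in> {a}" for u v
        using Ax[OF that(1)] that(2) ab bc by auto
      show "u < v" if "u \<in> {a}" "v \<in> B \<inter> set y" for u v
        using By[OF that(2)] that(1) ab bc by auto
      show "u < v" if "u \<in> A \<inter> set x" "v \<in> B \<inter> set y" for u v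
        using Ax[OF that(1)] By[OF that(2)] ab bc by auto
    qed (use incA incB ab bc in auto)
    have B': "chain (x @ [b, c, a] @ y) B'"
    proof (unfold B'_def, rule chain_blockI[OF d'])
      show "u < v" if "u \<in> B \<inter> set x" "v \<in> {b, c}" for u v
        using Bx[OF that(1)] that(2) ab bc by auto
      show "u < v" if "u \<in> {b, c}" "v \<in> A \<inter> set y" for u v
        using Ay[OF that(2)] that(1) ab bc by auto
      show "u < v" if "u \<in> B \<inter> set x" "v \<in> A \<inter> set y" for u v
        using Bx[OF that(1)] Ay[OF that(2)] ab bc by auto
    qed (use incA incB ab bc in auto)
    have "A' \<union> B' = A \<union> B"
      using A B aA cA True aB bA unfolding A'_def B'_def chain_def by auto
    then show ?thesis using A' B' True by (metis empty_iff)
  qed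
qed

text \<open>The same exchange as in \<open>chains_le_bac\<close>, with \<open>b\<close> now to the
  right of the swapped pair: a free \<open>b\<close> replaces \<open>c\<close>; otherwise
  \<open>A\<close> passes from \<open>a\<close> to \<open>b\<close> and on along \<open>B\<close>,
  and \<open>B\<close> passes to \<open>c\<close> and on along \<open>A\<close>.\<close>

lemma chains_le_acb:
  assumes d: "distinct (x @ [a, c, b] @ y)" and ab: "a < b" and bc: "b < c"
  shows "chains_le (x @ [a, c, b] @ y) (x @ [c, a, b] @ y)"
proof (rule chains_le_from_disjoint[where a = a and c = c])
  fix A assume "chain (x @ [a, c, b] @ y) A" "\<not> (a \<in> A \<and> c \<in> A)"
  then show "chain (x @ [c, a, b] @ y) A" unfolding chain_def by auto
next
  fix A B assume A: "chain (x @ [a, c, b] @ y) A" and B: "chain (x @ [a, c, b] @ y) B"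
    and dis: "A \<inter> B = {}" and aA: "a \<in> A" and cA: "c \<in> A"
  have d': "distinct (x @ [c, a, b] @ y)" using d by auto
  have aB: "a \<notin> B" "c \<notin> B" using dis aA cA by auto
  have bA: "b \<notin> A" using A aA cA ab bc unfolding chain_def by auto
  have fin: "finite A" "finite B" using A B finite_chain by auto
  have incA: "inc_on x (A \<inter> set x)" "inc_on y (A \<inter> set y)"
    and incB: "inc_on x (B \<inter> set x)" "inc_on y (B \<inter> set y)"
    using A B unfolding chain_def by (auto intro: inc_on_mono[OF _ Int_lower1])
  have Ax: "u < a" if "u \<in> A \<inter> set x" for u using A aA that unfolding chain_def by auto
  have Ay: "c < u" if "u \<in> A \<inter> set y" for u using A cA that unfolding chain_def by auto
  show "\<exists>A' B'. chain (x @ [c, a, b] @ y) A' \<and> chain (x @ [c, a, b] @ y) B' \<and>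
     card (A' \<union> B') = card (A \<union> B) \<and> (B = {} \<longrightarrow> B' = {})"
  proof (cases "b \<in> B")
    case False
    define A' where "A' = (A \<inter> set x) \<union> {a, b} \<union> (A \<inter> set y)"
    have A': "chain (x @ [c, a, b] @ y) A'"
    proof (unfold A'_def, rule chain_blockI[OF d'])
      show "u < v" if "u \<in> A \<inter> set x" "v \<in> {a, b}" for u v
        using Ax[OF that(1)] that(2) ab bc by auto
      show "u < v" if "u \<in> {a, b}" "v \<in> A \<inter> set y" for u v
        using Ay[OF that(2)] that(1) ab bc by auto
      show "u < v" if "u \<in> A \<inter> set x" "v \<in> A \<inter> set y" for u v
        using Ax[OF that(1)] Ay[OF that(2)] ab bc by auto
    qed (use incA ab bc in auto)
    have B': "chain (x @ [c, a, b] @ y) B" using B aB unfolding chain_def by auto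
    have eq: "A' = insert b (A - {c})"
      using A bA aA cA d unfolding A'_def chain_def by auto
    have "card (A' \<union> B) = card (A \<union> B)"
      by (rule card_exchange[of _ c b]) (use fin aA cA aB bA False in \<open>auto simp: eq\<close>)
    then show ?thesis using A' B' by blast
  next
    case True
    have Bx: "u < b" if "u \<in> B \<inter> set x" for u using B True that unfolding chain_def by auto
    have By: "b < u" if "u \<in> B \<inter> set y" for u using B True that unfolding chain_def by auto
    define A' where "A' = (A \<inter> set x) \<union> {a, b} \<union> (B \<inter> set y)"
    define B' where "B' = (B \<inter> set x) \<union> {c} \<union> (A \<inter> set y)"
    have A': "chain (x @ [c, a, b] @ y) A'"
    proof (unfold A'_def, rule chain_blockI[OF d'])
      show "u < v" if "u \<in> A \<inter> set x" "v \<in> {a, b}" for u v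
        using Ax[OF that(1)] that(2) ab bc by auto
      show "u < v" if "u \<in> {a, b}" "v \<in> B \<inter> set y" for u v
        using By[OF that(2)] that(1) ab bc by auto
      show "u < v" if "u \<in> A \<inter> set x" "v \<in> B \<inter> set y" for u v
        using Ax[OF that(1)] By[OF that(2)] ab bc by auto
    qed (use incA incB ab bc in auto)
    have B': "chain (x @ [c, a, b] @ y) B'"
    proof (unfold B'_def, rule chain_blockI[OF d'])
      show "u < v" if "u \<in> B \<inter> set x" "v \<in> {c}" for u v
        using Bx[OF that(1)] that(2) ab bc by auto
      show "u < v" if "u \<in> {c}" "v \<in> A \<inter> set y" for u v
        using Ay[OF that(2)] that(1) ab bc by auto
      show "u < v" if "u \<in> B \<inter> set x" "v \<in> A \<inter> set y" for u v
        using Bx[OF that(1)] Ay[OF that(2)] ab bc by auto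
    qed (use incA incB ab bc in auto)
    have "A' \<union> B' = A \<union> B"
      using A B aA cA True aB bA unfolding A'_def B'_def chain_def by auto
    then show ?thesis using A' B' True by (metis empty_iff)
  qed
qed

section \<open>Knuth relations, and row insertion as a sequence of Knuth moves\<close>

inductive knuth :: "int list \<Rightarrow> int list \<Rightarrow> bool" where
  bca: "a < b \<Longrightarrow> b < c \<Longrightarrow> knuth (x @ [b, c, a] @ y) (x @ [b, a, c] @ y)"
| acb: "a < b \<Longrightarrow> b < c \<Longrightarrow> knuth (x @ [a, c, b] @ y) (x @ [c, a, b] @ y)"

lemma knuth_context: "knuth u v \<Longrightarrow> knuth (x @ u @ y) (x @ v @ y)"
proof (induction rule: knuth.induct)
  case (bca a b c x' y') then show ?case using knuth.bca[of a b c "x @ x'" "y' @ y"] by simp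
next
  case (acb a b c x' y') then show ?case using knuth.acb[of a b c "x @ x'" "y' @ y"] by simp
qed

lemma knuths_context: "knuth\<^sup>*\<^sup>* u v \<Longrightarrow> knuth\<^sup>*\<^sup>* (x @ u @ y) (x @ v @ y)"
  by (induction rule: rtranclp_induct) (auto intro: knuth_context rtranclp.rtrancl_into_rtrancl)

text \<open>The rules of \<open>knuth\<close> carry only the orientation that insertion uses. One
  direction of each comparison is the exchange argument, the other merely undoes a descent.\<close>

lemma knuth_chains:
  assumes "knuth xs ys" "distinct xs"
  shows "chains_le xs ys \<and> chains_le ys xs \<and> distinct ys \<and> set ys = set xs"
  using assms
proof (induction rule: knuth.induct)
  case (bca a b c x y)
  then show ?case
    using chains_le_bac[of x b a c y] chains_le_transpose[of a c "x @ [b]" y] by auto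
next
  case (acb a b c x y)
  then show ?case
    using chains_le_acb[of x a c b y] chains_le_transpose[of a c x "b # y"] by auto
qed

lemma knuths_chains:
  assumes "knuth\<^sup>*\<^sup>* xs ys" "distinct xs"
  shows "chains_le xs ys \<and> chains_le ys xs \<and> distinct ys \<and> set ys = set xs"
  using assms
proof (induction rule: rtranclp_induct)
  case base then show ?case by (auto intro: chains_le_refl)
next
  case (step y z)
  then show ?case using knuth_chains[of y z] chains_le_trans by blast
qed

lemma row_ins_split:
  "sorted_wrt (<) r \<Longrightarrow> x \<notin> set r \<Longrightarrow>
   (row_ins x r = (r @ [x], None) \<and> (\<forall>z\<in>set r. z < x)) \<or>
   (\<exists>r1 y r2. r = r1 @ y # r2 \<and> row_ins x r = (r1 @ x # r2, Some y) \<and> (\<forall>z\<in>set r1. z < x) \<and> x < y)"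
proof (induction r)
  case (Cons z r)
  show ?case
  proof (cases "x < z")
    case True
    then show ?thesis by (intro disjI2 exI[of _ "[]"]) simp
  next
    case False
    then have zx: "z < x" using Cons.prems by auto
    from Cons consider "row_ins x r = (r @ [x], None)" "\<forall>z\<in>set r. z < x"
      | r1 y r2 where "r = r1 @ y # r2" "row_ins x r = (r1 @ x # r2, Some y)" "\<forall>z\<in>set r1. z < x" "x < y"
      by auto
    then show ?thesis
    proof cases
      case 1 then show ?thesis using zx by simp
    next
      case 2 then show ?thesis using zx by (intro disjI2 exI[of _ "z # r1"]) simp
    qed
  qed
qed simp

text \<open>\<open>x\<close> travels left through \<open>r\<close>; at each step it passes an entry
  whose left neighbour lies strictly between the two, as the rule \<open>bca\<close>
  demands.\<close>

lemma knuth_move_left: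
  "sorted_wrt (<) (y # r) \<Longrightarrow> x < y \<Longrightarrow> knuth\<^sup>*\<^sup>* (y # r @ [x]) (y # x # r)"
proof (induction r arbitrary: y)
  case (Cons z r)
  have "knuth\<^sup>*\<^sup>* (z # r @ [x]) (z # x # r)" using Cons by auto
  then have "knuth\<^sup>*\<^sup>* (y # z # r @ [x]) (y # z # x # r)"
    using knuths_context[of "z # r @ [x]" "z # x # r" "[y]" "[]"] by simp
  moreover have "knuth (y # z # x # r) (y # x # z # r)"
    using knuth.bca[of x y z "[]" r] Cons by simp
  ultimately show ?case by simp
qed simp

text \<open>\<open>y\<close> travels left through \<open>r\<close>; at each step it passes an entry
  while the former right neighbour of that entry, now just after \<open>y\<close>, serves as the
  middle value of the rule \<open>acb\<close>.\<close>

lemma knuth_move_front: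
  "sorted_wrt (<) (r @ [x]) \<Longrightarrow> x < y \<Longrightarrow> knuth\<^sup>*\<^sup>* (r @ [y, x]) (y # r @ [x])"
proof (induction r arbitrary: x rule: rev_induct)
  case (snoc z r)
  have "knuth (r @ [z, y, x]) (r @ [y, z, x])"
    using knuth.acb[of z x y r "[]"] snoc.prems by (simp add: sorted_wrt_append)
  moreover have "knuth\<^sup>*\<^sup>* (r @ [y, z]) (y # r @ [z])"
    using snoc by (auto simp: sorted_wrt_append)
  then have "knuth\<^sup>*\<^sup>* (r @ [y, z, x]) (y # r @ [z, x])"
    using knuths_context[of "r @ [y, z]" "y # r @ [z]" "[]" "[x]"] by simp
  ultimately show ?case by (simp add: converse_rtranclp_into_rtranclp)
qed simp

lemma knuth_row_bump:
  assumes "sorted_wrt (<) (r1 @ y # r2)" "\<forall>z\<in>set r1. z < x" "x < y"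
  shows "knuth\<^sup>*\<^sup>* (r1 @ y # r2 @ [x]) (y # r1 @ x # r2)"
proof -
  have "knuth\<^sup>*\<^sup>* (r1 @ y # r2 @ [x]) (r1 @ y # x # r2)"
    using knuths_context[OF knuth_move_left[of y r2 x], of r1 "[]"] assms
    by (simp add: sorted_wrt_append)
  also have "knuth\<^sup>*\<^sup>* (r1 @ y # x # r2) (y # r1 @ x # r2)"
    using knuths_context[OF knuth_move_front[of r1 x y], of "[]" r2] assms
    by (simp add: sorted_wrt_append)
  finally (rtranclp_trans) show ?thesis .
qed

definition reading_word :: "int list list \<Rightarrow> int list" where
  "reading_word T = concat (rev T)"

lemma reading_word_simps [simp]:
  "reading_word [] = []" "reading_word (r # T) = reading_word T @ r"
  by (simp_all add: reading_word_def)

text \<open>In the reading word, bumping \<open>y\<close> out of a row moves it to the front of that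
  row, hence to the end of the word of the rows below. There it is in position to be inserted into
  them, which is the induction step.\<close>

lemma knuth_tab_ins:
  "\<forall>r\<in>set T. sorted_wrt (<) r \<Longrightarrow> distinct (reading_word T @ [x]) \<Longrightarrow>
   knuth\<^sup>*\<^sup>* (reading_word T @ [x]) (reading_word (tab_ins x T))"
proof (induction T arbitrary: x)
  case (Cons r T)
  have "sorted_wrt (<) r" "x \<notin> set r" using Cons.prems by auto
  from row_ins_split[OF this] show ?case
  proof (elim disjE exE conjE)
    assume "row_ins x r = (r @ [x], None)" then show ?thesis by simp
  next
    fix r1 y r2 assume *: "r = r1 @ y # r2" "row_ins x r = (r1 @ x # r2, Some y)"
      "\<forall>z\<in>set r1. z < x" "x < y"
    have "knuth\<^sup>*\<^sup>* (reading_word T @ r1 @ y # r2 @ [x]) (reading_word T @ y # r1 @ x # r2)"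
      using knuths_context[OF knuth_row_bump[of r1 y r2 x], of "reading_word T" "[]"] * Cons.prems by simp
    also have "knuth\<^sup>*\<^sup>* (reading_word T @ [y]) (reading_word (tab_ins y T))"
      by (rule Cons.IH) (use Cons.prems * in auto)
    then have "knuth\<^sup>*\<^sup>* (reading_word T @ y # r1 @ x # r2) (reading_word (tab_ins y T) @ r1 @ x # r2)"
      using knuths_context[of "reading_word T @ [y]" "reading_word (tab_ins y T)" "[]" "r1 @ x # r2"] by simp
    finally (rtranclp_trans) show ?thesis using * by simp
  qed
qed simp

section \<open>Row insertion preserves tableaux\<close>

definition first_row :: "int list list \<Rightarrow> int list" where
  "first_row T = (case T of [] \<Rightarrow> [] | r # _ \<Rightarrow> r)"

lemma first_row_simps [simp]: "first_row [] = []" "first_row (r # T) = r"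
  by (simp_all add: first_row_def)

definition row_above :: "int list \<Rightarrow> int list \<Rightarrow> bool" where
  "row_above r s \<longleftrightarrow> length s \<le> length r \<and> (\<forall>j<length s. r ! j < s ! j)"

fun is_tableau :: "int list list \<Rightarrow> bool" where
  "is_tableau [] \<longleftrightarrow> True"
| "is_tableau (r # T) \<longleftrightarrow>
     r \<noteq> [] \<and> sorted_wrt (<) r \<and> row_above r (first_row T) \<and> is_tableau T"

text \<open>The bumped \<open>y\<close> never lands further right than the place it left: the entry
  below that place, if any, exceeds \<open>y\<close>. So \<open>y\<close> comes to stand below
  \<open>x\<close> or below an entry of \<open>r1\<close>, both smaller than \<open>y\<close>, and
  elsewhere the upper row has only decreased.\<close>

lemma row_above_bump:
  assumes "sorted_wrt (<) (r1 @ y # r2)" "row_above (r1 @ y # r2) s" "x < y"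
    "sorted_wrt (<) s" "y \<notin> set s"
  shows "row_above (r1 @ x # r2) (fst (row_ins y s))"
proof -
  have le: "(r1 @ x # r2) ! j \<le> (r1 @ y # r2) ! j" for j
    using assms(3) by (auto simp: nth_append nth_Cons split: nat.split)
  have dom: "(r1 @ y # r2) ! j < s ! j" if "j < length s" for j
    using assms(2) that by (auto simp: row_above_def)
  have col: "(r1 @ x # r2) ! j < s ! j" if "j < length s" for j
    using le[of j] dom[OF that] by simp
  have low: "(r1 @ x # r2) ! j < y" if "j \<le> length r1" for j
    using that assms(1,3) by (cases "j = length r1") (auto simp: nth_append sorted_wrt_append)
  from row_ins_split[OF assms(4,5)] show ?thesis
  proof (elim disjE exE conjE)
    assume *: "row_ins y s = (s @ [y], None)" "\<forall>z\<in>set s. z < y"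
    have "length s \<le> length r1"
    proof (rule ccontr)
      assume "\<not> ?thesis"
      then have "y < s ! length r1" "s ! length r1 \<in> set s" using dom[of "length r1"] by auto
      then show False using * by auto
    qed
    then show ?thesis using * col low[of "length s"]
      by (auto simp: row_above_def nth_append less_Suc_eq)
  next
    fix s1 z s2 assume *: "s = s1 @ z # s2" "row_ins y s = (s1 @ y # s2, Some z)"
      "\<forall>z\<in>set s1. z < y" "y < z"
    have "length s1 \<le> length r1"
    proof (rule ccontr)
      assume "\<not> ?thesis"
      then have "y < s1 ! length r1" "s1 ! length r1 \<in> set s1"
        using dom[of "length r1"] * by (auto simp: nth_append)
      then show False using * by auto
    qed
    then have "(r1 @ x # r2) ! j < (s1 @ y # s2) ! j" if "j < length s" for j
      using col[OF that] low[of j] * by (cases "j = length s1") (auto simp: nth_append nth_Cons')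
    then show ?thesis using * assms(2) by (auto simp: row_above_def)
  qed
qed

lemma first_row_tab_ins: "first_row (tab_ins x T) = fst (row_ins x (first_row T))"
  by (cases T) (auto split: prod.splits option.splits)

lemma is_tableau_tab_ins:
  "is_tableau T \<Longrightarrow> distinct (reading_word T @ [x]) \<Longrightarrow> is_tableau (tab_ins x T)"
proof (induction T arbitrary: x)
  case Nil then show ?case by (simp add: row_above_def)
next
  case (Cons r T)
  have r: "sorted_wrt (<) r" "x \<notin> set r" using Cons.prems by auto
  from row_ins_split[OF r] show ?case
  proof (elim disjE exE conjE)
    assume "row_ins x r = (r @ [x], None)" "\<forall>z\<in>set r. z < x"
    then show ?thesis using Cons.prems by (auto simp: sorted_wrt_append row_above_def nth_append)
  next
    fix r1 y r2 assume *: "r = r1 @ y # r2" "row_ins x r = (r1 @ x # r2, Some y)"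
      "\<forall>z\<in>set r1. z < x" "x < y"
    have T: "is_tableau (tab_ins y T)" by (rule Cons.IH) (use Cons.prems * in auto)
    have "sorted_wrt (<) (first_row T)" "y \<notin> set (first_row T)"
      using Cons.prems * by (cases T; auto)+
    then have "row_above (r1 @ x # r2) (first_row (tab_ins y T))"
      unfolding first_row_tab_ins using Cons.prems * by (intro row_above_bump) auto
    moreover have "sorted_wrt (<) (r1 @ x # r2)" using Cons.prems(1) *
      by (auto simp: sorted_wrt_append)
    ultimately show ?thesis using T * by simp
  qed
qed

lemma is_tableau_rows: "is_tableau T \<Longrightarrow> r \<in> set T \<Longrightarrow> sorted_wrt (<) r \<and> r \<noteq> []"
  by (induction T) auto

lemma rsk_P_knuth:
  "distinct xs \<Longrightarrow> is_tableau (rsk_P xs) \<and> knuth\<^sup>*\<^sup>* xs (reading_word (rsk_P xs))"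
proof (induction xs rule: rev_induct)
  case (snoc x xs)
  then have T: "is_tableau (rsk_P xs)" and k: "knuth\<^sup>*\<^sup>* xs (reading_word (rsk_P xs))" by auto
  have P: "rsk_P (xs @ [x]) = tab_ins x (rsk_P xs)" by (simp add: rsk_P_def)
  have d: "distinct (reading_word (rsk_P xs) @ [x])"
    using knuths_chains[OF k] snoc.prems by auto
  have "knuth\<^sup>*\<^sup>* (xs @ [x]) (reading_word (rsk_P xs) @ [x])"
    using knuths_context[OF k, of "[]" "[x]"] by simp
  also have "knuth\<^sup>*\<^sup>* \<dots> (reading_word (tab_ins x (rsk_P xs)))"
    by (rule knuth_tab_ins) (use T d is_tableau_rows in auto)
  finally (rtranclp_trans) show ?case using is_tableau_tab_ins[OF T d] unfolding P by simp
qed (simp add: rsk_P_def)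

section \<open>Greene's invariants of a tableau from its columns and rows\<close>

fun column :: "int list list \<Rightarrow> nat \<Rightarrow> int set" where
  "column [] j = {}"
| "column (r # T) j = (if j < length r then {r ! j} else {}) \<union> column T j"

lemma column_bound:
  "is_tableau T \<Longrightarrow> v \<in> column T j \<Longrightarrow> j < length (first_row T) \<and> first_row T ! j \<le> v"
proof (induction T)
  case (Cons r T)
  then show ?case by (auto simp: row_above_def split: if_splits)
qed simp

lemma column_subset_reading_word: "column T j \<subseteq> set (reading_word T)"
  by (induction T) auto

lemma reading_word_columns:
  "is_tableau T \<Longrightarrow> set (reading_word T) \<subseteq> (\<Union>j<length (first_row T). column T j)"
proof (induction T)
  case (Cons r T)
  have "set (reading_word T) \<subseteq> (\<Union>j<length r. column T j)"
  proof
    fix v assume "v \<in> set (reading_word T)"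
    then obtain j where "j < length (first_row T)" "v \<in> column T j" using Cons by auto
    then show "v \<in> (\<Union>j<length r. column T j)" using Cons.prems by (auto simp: row_above_def)
  qed
  then show ?case by (auto simp: in_set_conv_nth)
qed simp

text \<open>The reading word lists lower rows first while columns increase downwards, so each column
  occurs in it as a decreasing subsequence.\<close>

lemma chain_meets_column_once:
  "is_tableau T \<Longrightarrow> inc_on (reading_word T) A \<Longrightarrow> u \<in> A \<Longrightarrow> v \<in> A \<Longrightarrow>
   u \<in> column T j \<Longrightarrow> v \<in> column T j \<Longrightarrow> u = v"
proof (induction T)
  case (Cons r T)
  have *: "z \<notin> A" if "j < length r" "r ! j \<in> A" "z \<in> column T j" for z
  proof
    assume "z \<in> A"
    moreover have "r ! j < z" using column_bound[of T z j] that Cons.prems(1)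
      by (auto simp: row_above_def)
    moreover have "z \<in> set (reading_word T)" using that column_subset_reading_word by blast
    moreover have "r ! j \<in> set r" using that by simp
    moreover have "\<forall>u\<in>set (reading_word T) \<inter> A. \<forall>v\<in>set r \<inter> A. u < v"
      using Cons.prems(2) by simp
    ultimately show False using that(2) by (meson IntI less_asym)
  qed
  then show ?case using Cons by (auto split: if_splits)
qed simp

lemma card_chain_column:
  assumes "is_tableau T" "chain (reading_word T) A"
  shows "card (A \<inter> column T j) \<le> 1"
proof -
  have "finite (A \<inter> column T j)" using assms finite_chain by blast
  then show ?thesis
    unfolding card_le_Suc0_iff_eq[OF \<open>finite _\<close>, folded One_nat_def]
    using chain_meets_column_once assms unfolding chain_def by blast
qed

lemma card_by_columns:
  assumes "is_tableau T" "S \<subseteq> set (reading_word T)"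
  shows "card S \<le> (\<Sum>j<length (first_row T). card (S \<inter> column T j))"
proof -
  have "S = (\<Union>j<length (first_row T). S \<inter> column T j)"
    using reading_word_columns[OF assms(1)] assms(2) by blast
  then show ?thesis by (metis card_UN_le finite_lessThan)
qed

lemma card_chain_tableau:
  assumes "is_tableau T" "chain (reading_word T) A"
  shows "card A \<le> length (first_row T)"
proof -
  have "card A \<le> (\<Sum>j<length (first_row T). card (A \<inter> column T j))"
    by (rule card_by_columns) (use assms in \<open>auto simp: chain_def\<close>)
  also have "\<dots> \<le> (\<Sum>j<length (first_row T). 1)"
    by (rule sum_mono) (rule card_chain_column[OF assms])
  finally show ?thesis by simp
qed

text \<open>Every column contributes at most two elements to the union, one per chain. A column
  beyond the end of the second row consists of a single box and contributes at most one.\<close>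

lemma card_chains_tableau:
  assumes T: "is_tableau T" and A: "chain (reading_word T) A" and B: "chain (reading_word T) B"
  shows "card (A \<union> B) \<le> length (first_row T) + length (first_row (tl T))"
proof -
  let ?m = "length (first_row T)" and ?k = "length (first_row (tl T))"
  have km: "?k \<le> ?m" using T by (cases T) (auto simp: row_above_def)
  have one: "card ((A \<union> B) \<inter> column T j) \<le> 1 + (if j < ?k then 1 else 0)" for j
  proof (cases "j < ?k")
    case True
    have "card ((A \<union> B) \<inter> column T j) \<le> card (A \<inter> column T j) + card (B \<inter> column T j)"
      by (simp add: Int_Un_distrib2 card_Un_le)
    then show ?thesis
      using card_chain_column[OF T A, of j] card_chain_column[OF T B, of j] True by simp
  next
    case False
    have "\<exists>v. column T j \<subseteq> {v}"
    proof (cases T)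
      case (Cons r T')
      then have "column T' j = {}" using column_bound[of T' _ j] T False by auto
      then show ?thesis using Cons by auto
    qed auto
    then obtain v where "column T j \<subseteq> {v}" by blast
    then have "card ((A \<union> B) \<inter> column T j) \<le> card {v}" by (intro card_mono) auto
    then show ?thesis by simp
  qed
  have "card (A \<union> B) \<le> (\<Sum>j<?m. card ((A \<union> B) \<inter> column T j))"
    by (rule card_by_columns) (use assms in \<open>auto simp: chain_def\<close>)
  also have "\<dots> \<le> (\<Sum>j<?m. 1 + (if j < ?k then 1 else 0))"
    by (rule sum_mono) (rule one)
  also have "\<dots> = ?m + card {j \<in> {..<?m}. j < ?k}"
    by (simp only: sum.distrib sum.inter_filter[OF finite_lessThan, symmetric]) simp
  also have "{j \<in> {..<?m}. j < ?k} = {..<?k}" using km by auto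
  finally show ?thesis by simp
qed

lemma inc_on_sorted: "sorted_wrt (<) r \<Longrightarrow> inc_on r A"
  unfolding inc_on_def by (erule sorted_wrt_mono_rel[rotated]) simp

lemma inc_on_disjoint: "set xs \<inter> A = {} \<Longrightarrow> inc_on xs A"
  by (induction xs) auto

text \<open>The bounds are attained by the first row and the second row themselves, which are
  contiguous increasing factors of the reading word.\<close>

lemma rows_attain:
  assumes T: "is_tableau T" and d: "distinct (reading_word T)"
  shows "\<exists>A B. chain (reading_word T) A \<and> chain (reading_word T) B \<and>
    card A = length (first_row T) \<and> card (A \<union> B) = length (first_row T) + length (first_row (tl T))"
proof (cases T)
  case Nil
  then show ?thesis by (intro exI[of _ "{}"]) (simp add: chain_def)
next
  case (Cons r T')
  have r: "distinct r" "set (reading_word T') \<inter> set r = {}" "sorted_wrt (<) r"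
    using T d Cons by auto
  have A: "chain (reading_word T) (set r)"
    using r Cons by (auto simp: chain_def intro: inc_on_sorted inc_on_disjoint)
  have "chain (reading_word T) (set (first_row T')) \<and> distinct (first_row T') \<and>
    set (first_row T') \<inter> set r = {}"
  proof (cases T')
    case Nil then show ?thesis using Cons by (simp add: chain_def inc_on_disjoint)
  next
    case (Cons s T'')
    then have "inc_on s (set s)" "inc_on r (set s)" "inc_on (reading_word T'') (set s)"
      using \<open>T = r # T'\<close> T d by (auto intro: inc_on_sorted inc_on_disjoint)
    then show ?thesis using \<open>T = r # T'\<close> Cons d by (auto simp: chain_def)
  qed
  then show ?thesis using A r(1) Cons
    by (intro exI[of _ "set r"] exI[of _ "set (first_row T')"])
       (auto simp: distinct_card card_Un_disjoint Int_commute)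
qed

lemma is_tableau_shape:
  "is_tableau T \<Longrightarrow> sorted_wrt (\<ge>) (map length T) \<and> (\<forall>x\<in>set (map length T). 0 < x \<and> x \<le> length (first_row T))"
proof (induction T)
  case (Cons r T)
  then have "length (first_row T) \<le> length r" by (simp add: row_above_def)
  then show ?case using Cons by fastforce
qed simp

lemma length_reading_word: "length (reading_word T) = sum_list (map length T)"
  by (induction T) auto

lemma sum_list_take_shape:
  "sum_list (take 1 (map length T)) = length (first_row T)"
  "sum_list (take 2 (map length T)) = length (first_row T) + length (first_row (tl T))"
  by (cases T; simp; cases "tl T"; simp)+

text \<open>The values for the reading word of the insertion tableau are transported to
  \<open>xs\<close> in both directions along Knuth moves. Partial sums via \<open>take\<close> treat
  missing rows as rows of length zero.\<close>

theorem greene_two_rows: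
  assumes d: "distinct xs"
  shows chain_le_row: "chain xs A \<Longrightarrow> card A \<le> sum_list (take 1 (rsk_shape xs))"
    and ex_chain_row: "\<exists>A. chain xs A \<and> card A = sum_list (take 1 (rsk_shape xs))"
    and chains_le_rows: "chain xs A \<Longrightarrow> chain xs B \<Longrightarrow> card (A \<union> B) \<le> sum_list (take 2 (rsk_shape xs))"
    and ex_chains_rows: "\<exists>A B. chain xs A \<and> chain xs B \<and> card (A \<union> B) = sum_list (take 2 (rsk_shape xs))"
    and sum_rsk_shape: "sum_list (rsk_shape xs) = length xs"
    and sorted_rsk_shape: "sorted_wrt (\<ge>) (rsk_shape xs)"
    and rsk_shape_pos: "\<forall>x\<in>set (rsk_shape xs). 0 < x"
proof -
  define T where "T = rsk_P xs"
  have T: "is_tableau T" and k: "knuth\<^sup>*\<^sup>* xs (reading_word T)" using rsk_P_knuth[OF d] T_def by auto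
  have le: "chains_le xs (reading_word T)" and ge: "chains_le (reading_word T) xs"
    and dT: "distinct (reading_word T)" and sT: "set (reading_word T) = set xs"
    using knuths_chains[OF k d] by auto
  have e: "chain ys {}" for ys by (simp add: chain_def inc_on_disjoint)
  have sh: "rsk_shape xs = map length T" by (simp add: rsk_shape_def T_def)
  obtain A0 B0 where r: "chain (reading_word T) A0" "chain (reading_word T) B0"
    "card A0 = length (first_row T)" "card (A0 \<union> B0) = length (first_row T) + length (first_row (tl T))"
    using rows_attain[OF T dT] by blast
  show "card A \<le> sum_list (take 1 (rsk_shape xs))" if A: "chain xs A" for A
  proof -
    \<comment> \<open>With an empty second chain, \<open>chains_le\<close> returns an empty second
      chain and hence a single chain of the same size.\<close>
    obtain A' where "chain (reading_word T) A'" "card A' = card A"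
      using le A e[of xs] unfolding chains_le_def by fastforce
    then show ?thesis using card_chain_tableau[OF T] unfolding sh sum_list_take_shape by metis
  qed
  show "\<exists>A. chain xs A \<and> card A = sum_list (take 1 (rsk_shape xs))"
  proof -
    obtain A' where "chain xs A'" "card A' = card A0"
      using ge r(1) e[of "reading_word T"] unfolding chains_le_def by fastforce
    then show ?thesis unfolding sh sum_list_take_shape using r by metis
  qed
  show "card (A \<union> B) \<le> sum_list (take 2 (rsk_shape xs))" if AB: "chain xs A" "chain xs B" for A B
  proof -
    obtain A' B' where "chain (reading_word T) A'" "chain (reading_word T) B'" "card (A' \<union> B') = card (A \<union> B)"
      using le AB unfolding chains_le_def by metis
    then show ?thesis using card_chains_tableau[OF T] unfolding sh sum_list_take_shape by metis
  qed
  show "\<exists>A B. chain xs A \<and> chain xs B \<and> card (A \<union> B) = sum_list (take 2 (rsk_shape xs))"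
    using ge r unfolding chains_le_def sh sum_list_take_shape by metis
  show "sum_list (rsk_shape xs) = length xs"
    unfolding sh length_reading_word[symmetric] using d dT sT by (metis distinct_card)
  show "sorted_wrt (\<ge>) (rsk_shape xs)" "\<forall>x\<in>set (rsk_shape xs). 0 < x"
    using is_tableau_shape[OF T] unfolding sh by auto
qed

section \<open>Bad signed permutations and the weak order\<close>

text \<open>\<open>w\<close> as an odd function on positions \<open>- n, ..., n\<close>; the value \<open>0\<close> at position \<open>0\<close> makes
  \<open>s\<^sub>0\<close> a descent exactly when the consecutive values at \<open>0\<close> and \<open>1\<close> decrease.\<close>

definition val :: "int list \<Rightarrow> int \<Rightarrow> int" where
  "val w p = (if 0 < p then w ! (nat p - 1) else if p < 0 then - (w ! (nat (- p) - 1)) else 0)"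

text \<open>The generator \<open>s_i\<close> as a permutation of signed positions. Right
  multiplication by it turns into composition of \<open>val\<close> with this map, see
  \<open>val_gen_act\<close>.\<close>

definition gen_perm :: "nat \<Rightarrow> int \<Rightarrow> int" where
  "gen_perm i p = (if i = 0 then (if \<bar>p\<bar> = 1 then - p else p)
     else if p = int i then int i + 1 else if p = int i + 1 then int i
     else if p = - int i then - int i - 1 else if p = - int i - 1 then - int i else p)"

definition triple :: "nat \<Rightarrow> (int \<Rightarrow> int) \<Rightarrow> int \<Rightarrow> int \<Rightarrow> int \<Rightarrow> bool" where
  "triple n f a b c \<longleftrightarrow> a < b \<and> b < c \<and> a \<noteq> 0 \<and> b \<noteq> 0 \<and> c \<noteq> 0 \<and>
     \<bar>a\<bar> \<le> int n \<and> \<bar>b\<bar> \<le> int n \<and> \<bar>c\<bar> \<le> int n \<and>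
     \<bar>a\<bar> \<noteq> \<bar>b\<bar> \<and> \<bar>b\<bar> \<noteq> \<bar>c\<bar> \<and> \<bar>a\<bar> \<noteq> \<bar>c\<bar> \<and> f b < f a \<and> f c < f b"

definition neg_pair :: "nat \<Rightarrow> (int \<Rightarrow> int) \<Rightarrow> int \<Rightarrow> int \<Rightarrow> bool" where
  "neg_pair n f j k \<longleftrightarrow> 0 < j \<and> j < k \<and> k \<le> int n \<and> f j < 0 \<and> f k < f j"

definition bad :: "nat \<Rightarrow> (int \<Rightarrow> int) \<Rightarrow> bool" where
  "bad n f \<longleftrightarrow> (\<exists>a b c. triple n f a b c) \<or> (\<exists>j k. neg_pair n f j k)"

definition descent :: "(int \<Rightarrow> int) \<Rightarrow> nat \<Rightarrow> bool" where
  "descent f i \<longleftrightarrow> f (int i + 1) < f (int i)"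

lemma gen_perm_invol [simp]: "gen_perm i (gen_perm i p) = p"
  by (auto simp: gen_perm_def)

lemma gen_perm_uminus [simp]: "gen_perm i (- p) = - gen_perm i p"
  by (auto simp: gen_perm_def)

lemma gen_perm_inj [simp]: "gen_perm i p = gen_perm i q \<longleftrightarrow> p = q"
  by (metis gen_perm_invol)

lemma gen_perm_0 [simp]: "gen_perm i p = 0 \<longleftrightarrow> p = 0"
  by (auto simp: gen_perm_def)

lemma gen_perm_zero [simp]: "gen_perm i 0 = 0"
  by simp

lemma gen_perm_abs [simp]: "\<bar>gen_perm i p\<bar> = \<bar>gen_perm i q\<bar> \<longleftrightarrow> \<bar>p\<bar> = \<bar>q\<bar>"
  unfolding abs_eq_iff by (metis gen_perm_inj gen_perm_uminus)

lemma gen_perm_bound: "i < n \<Longrightarrow> \<bar>p\<bar> \<le> int n \<Longrightarrow> \<bar>gen_perm i p\<bar> \<le> int n"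
  by (auto simp: gen_perm_def abs_if split: if_splits)

text \<open>Among nonzero positions \<open>s_0\<close> reverses only the pair \<open>-1, 1\<close>,
  which is excluded by the absolute values. For \<open>i > 0\<close> only \<open>i, i+1\<close> and
  its mirror image are reversed.\<close>

lemma gen_perm_less:
  assumes "p < q" "\<bar>p\<bar> \<noteq> \<bar>q\<bar>" "p \<noteq> 0" "q \<noteq> 0"
    "i \<noteq> 0 \<Longrightarrow> \<not> (p = int i \<and> q = int i + 1)" "i \<noteq> 0 \<Longrightarrow> \<not> (p = - int i - 1 \<and> q = - int i)"
  shows "gen_perm i p < gen_perm i q"
proof (cases "i = 0")
  case True
  then show ?thesis using assms(1-4) by (simp add: gen_perm_def) linarith
next
  case False
  then show ?thesis using assms(1,5,6) unfolding gen_perm_def by auto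
qed

lemma triple_gen_perm:
  assumes t: "triple n f a b c" and "i < n"
    and ab: "i \<noteq> 0 \<Longrightarrow> \<not> (a = int i \<and> b = int i + 1)" "i \<noteq> 0 \<Longrightarrow> \<not> (a = - int i - 1 \<and> b = - int i)"
    and bc: "i \<noteq> 0 \<Longrightarrow> \<not> (b = int i \<and> c = int i + 1)" "i \<noteq> 0 \<Longrightarrow> \<not> (b = - int i - 1 \<and> c = - int i)"
  shows "triple n (f \<circ> gen_perm i) (gen_perm i a) (gen_perm i b) (gen_perm i c)"
  using t gen_perm_less[OF _ _ _ _ ab] gen_perm_less[OF _ _ _ _ bc] gen_perm_bound[OF \<open>i < n\<close>]
  unfolding triple_def by simp

lemma neg_pair_gen_perm:
  assumes p: "neg_pair n f j k" and "i < n" "\<not> (i = 0 \<and> j = 1)" "\<not> (j = int i \<and> k = int i + 1)"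
  shows "neg_pair n (f \<circ> gen_perm i) (gen_perm i j) (gen_perm i k)"
  using p assms(2-4) unfolding neg_pair_def by (auto simp: gen_perm_def)

text \<open>Injectivity is required at position \<open>0\<close> too, so the value \<open>0\<close>
  occurs at no other position in range.\<close>

locale signed_map =
  fixes n :: nat and f :: "int \<Rightarrow> int"
  assumes odd: "f (- p) = - f p"
    and inj: "\<bar>p\<bar> \<le> int n \<Longrightarrow> \<bar>q\<bar> \<le> int n \<Longrightarrow> f p = f q \<Longrightarrow> p = q"
begin

lemma f_0 [simp]: "f 0 = 0"
  using odd[of 0] by simp

lemma triple_uminus: "triple n f a b c \<Longrightarrow> triple n f (- c) (- b) (- a)"
  by (auto simp: triple_def odd)

lemma adjacent_descents_bad:
  assumes "Suc i < n" "descent f i" "descent f (Suc i)" shows "bad n f"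
proof (cases "i = 0")
  case True
  then have "neg_pair n f 1 2" using assms by (simp add: descent_def neg_pair_def)
  then show ?thesis unfolding bad_def by blast
next
  case False
  then have "triple n f (int i) (int i + 1) (int i + 2)"
    using assms by (simp add: descent_def triple_def algebra_simps)
  then show ?thesis unfolding bad_def by blast
qed

text \<open>The descent of \<open>f\<close> at \<open>i\<close> is an ascent of the shorter map. A
  bad pattern of the shorter map therefore contains no pair that \<open>s_i\<close> reverses, and
  \<open>s_i\<close> carries it to a bad pattern of \<open>f\<close>.\<close>

lemma bad_weak_order:
  assumes "i < n" "descent f i" "bad n (f \<circ> gen_perm i)" shows "bad n f"
proof -
  let ?g = "f \<circ> gen_perm i"
  have g: "?g \<circ> gen_perm i = f" by auto
  have "?g (int i) < ?g (int i + 1)" "?g (- int i - 1) < ?g (- int i)" if "i \<noteq> 0"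
    using that assms(2) odd[of "int i"] odd[of "int i + 1"] by (simp_all add: descent_def gen_perm_def)
  then have asc: "\<not> ?g q < ?g p"
    if "i \<noteq> 0" "p = int i \<and> q = int i + 1 \<or> p = - int i - 1 \<and> q = - int i" for p q
    using that less_asym by blast
  from assms(3) consider a b c where "triple n ?g a b c" | j k where "neg_pair n ?g j k"
    unfolding bad_def by blast
  then show ?thesis
  proof cases
    case 1
    then have lt: "?g b < ?g a" "?g c < ?g b" by (simp_all add: triple_def)
    have "triple n (?g \<circ> gen_perm i) (gen_perm i a) (gen_perm i b) (gen_perm i c)"
      by (rule triple_gen_perm[OF 1 assms(1)]) (use asc lt in blast)+
    then show ?thesis unfolding g bad_def by blast
  next
    case 2
    then have *: "?g k < ?g j" "?g j < 0" "0 < j" by (simp_all add: neg_pair_def)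
    then have "\<not> (i = 0 \<and> j = 1)" using assms(2) odd[of 1] by (auto simp: descent_def gen_perm_def)
    moreover have "\<not> (j = int i \<and> k = int i + 1)" using asc[of j k] * by auto
    ultimately show ?thesis using neg_pair_gen_perm[OF 2 assms(1)] unfolding g bad_def by blast
  qed
qed

text \<open>Some step from \<open>r\<close> to \<open>r + 1\<close> between \<open>p\<close> and
  \<open>q\<close> must go down. For negative \<open>r\<close> it is the mirror image of the descent
  at \<open>- r - 1\<close>, which accounts for the second alternative.\<close>

lemma descent_between:
  assumes "p < q" "f q < f p" "\<bar>p\<bar> \<le> int n" "\<bar>q\<bar> \<le> int n"
  obtains i where "i < n" "descent f i"
    "p \<le> int i \<and> int i + 1 \<le> q \<or> p \<le> - int i - 1 \<and> - int i \<le> q"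
proof -
  have "\<exists>r. p \<le> r \<and> r < q \<and> f (r + 1) < f r"
  proof (rule ccontr)
    assume "\<not> ?thesis"
    then have *: "f r \<le> f (r + 1)" if "p \<le> r" "r < q" for r using that by force
    have "s \<le> q \<longrightarrow> f p \<le> f s" if "p \<le> s" for s
      using that
    proof (induction s rule: int_ge_induct)
      case (step s) then show ?case using *[of s] by auto
    qed simp
    from this[of q] show False using assms by simp
  qed
  then obtain r where r: "p \<le> r" "r < q" "f (r + 1) < f r" by blast
  show ?thesis
  proof (cases "0 \<le> r")
    case True
    then show ?thesis using r assms that[of "nat r"] by (auto simp: descent_def)
  next
    case False
    moreover have "f (- r - 1) = - f (r + 1)" "f (- r) = - f r"
      using odd[of "r + 1"] odd[of r] by simp_all
    ultimately show ?thesis using r assms that[of "nat (- r - 1)"] by (simp add: descent_def)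
  qed
qed

text \<open>If no descent keeps \<open>f\<close> bad, then every descent swaps two entries of every bad triple,
  which forces such a triple to occupy three consecutive positions.\<close>

lemma bad_descend:
  assumes "bad n f"
  shows "(\<exists>i. Suc i < n \<and> descent f i \<and> descent f (Suc i)) \<or>
    (\<exists>i<n. descent f i \<and> bad n (f \<circ> gen_perm i))"
proof (rule ccontr)
  assume neg: "\<not> ?thesis"
  then have nadj: "\<not> (Suc i < n \<and> descent f i \<and> descent f (Suc i))" for i by blast
  have broken: "i \<noteq> 0 \<and> (a = int i \<and> b = int i + 1 \<or> b = int i \<and> c = int i + 1 \<or>
     a = - int i - 1 \<and> b = - int i \<or> b = - int i - 1 \<and> c = - int i)"
    if t: "triple n f a b c" and i: "i < n" "descent f i" for a b c i
  proof (rule ccontr)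
    assume no: "\<not> ?thesis"
    have "triple n (f \<circ> gen_perm i) (gen_perm i a) (gen_perm i b) (gen_perm i c)"
      using triple_gen_perm[OF t i(1)] no by blast
    then show False using neg i unfolding bad_def by blast
  qed
  \<comment> \<open>A descent between \<open>0\<close> and \<open>b\<close>, or between
    \<open>a\<close> and \<open>- c\<close>, would leave the triple intact. This forces
    \<open>0 < f b\<close> and \<open>f a \<le> f (- c)\<close>, and then \<open>b\<close> may be
    replaced by \<open>- b\<close>.\<close>
  have no_far: False if t: "triple n f a b c" and ab: "c = b + 1" "0 < b" "a < - c" for a b c
  proof -
    have bds: "\<bar>a\<bar> \<le> int n" "\<bar>b\<bar> \<le> int n" "\<bar>c\<bar> \<le> int n" using t by (auto simp: triple_def)
    have "0 < f b"
    proof (rule ccontr)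
      assume "\<not> ?thesis"
      then have "f b < f 0" using inj[of b 0] bds ab by (cases "f b = f 0") auto
      then obtain i where "i < n" "descent f i" "int i + 1 \<le> b"
        using descent_between[of 0 b] bds ab by force
      then show False using broken[OF t, of i] ab by auto
    qed
    have "f a \<le> f (- c)"
    proof (rule ccontr)
      assume "\<not> ?thesis"
      then obtain i where "i < n" "descent f i" "- int i \<le> - c"
        using descent_between[of a "- c"] bds ab by force
      then show False using broken[OF t, of i] ab by auto
    qed
    then have "f c < f (- b)" using t unfolding triple_def odd by linarith
    moreover have "f (- b) < f a" using t \<open>0 < f b\<close> unfolding triple_def odd by linarith
    ultimately have "triple n f a (- b) c" using t ab unfolding triple_def by simp
    \<comment> \<open>The descent at \<open>b\<close> swaps \<open>b\<close> with \<open>c\<close>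
      and \<open>- c\<close> with \<open>- b\<close>. Neither pair is consecutive in the triple
      \<open>a < - b < c\<close>, so the swap leaves it a triple.\<close>
    moreover have "nat b < n" "descent f (nat b)" using t ab by (auto simp: descent_def triple_def)
    ultimately show False using broken[of a "- b" c "nat b"] ab by auto
  qed
  from assms consider a b c where "triple n f a b c" | j k where "neg_pair n f j k"
    unfolding bad_def by blast
  then show False
  proof cases
    case t: 1
    note bds = t[unfolded triple_def]
    have ord: "a < b" "b < c" and ac: "a \<noteq> - c" using bds by auto
    have "b = a + 1"
    proof (rule ccontr)
      assume ne: "b \<noteq> a + 1"
      obtain i where i: "i < n" "descent f i"
        and bt: "a \<le> int i \<and> int i + 1 \<le> b \<or> a \<le> - int i - 1 \<and> - int i \<le> b"
        using descent_between[of a b] bds by metis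
      \<comment> \<open>The descent found between \<open>a\<close> and \<open>b\<close> can only
        disturb the pair \<open>b, c\<close>. It does so at \<open>i = b\<close>, and then lies
        between \<open>a\<close> and \<open>b\<close> only through its mirror image, whence
        \<open>a \<le> - c\<close>.\<close>
      then have "i \<noteq> 0" "b = int i \<and> c = int i + 1 \<or> b = - int i - 1 \<and> c = - int i"
        using broken[OF t i] ne by auto
      then have "c = b + 1 \<and> 0 < b \<and> a \<le> - c" using bt ord by (elim disjE) simp_all
      then show False using no_far[OF t] ac by auto
    qed
    moreover have "c = b + 1"
    proof (rule ccontr)
      assume ne: "c \<noteq> b + 1"
      obtain i where i: "i < n" "descent f i"
        and bt: "b \<le> int i \<and> int i + 1 \<le> c \<or> b \<le> - int i - 1 \<and> - int i \<le> c"
        using descent_between[of b c] bds by metis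
      then have "i \<noteq> 0" "a = int i \<and> b = int i + 1 \<or> a = - int i - 1 \<and> b = - int i"
        using broken[OF t i] ne by auto
      \<comment> \<open>The mirror image \<open>- c < - b < - a\<close> of the triple is in the
        situation of \<open>no_far\<close>.\<close>
      then have "- a = - b + 1 \<and> 0 < - b \<and> - c \<le> a" using bt ord by (elim disjE) simp_all
      then show False using no_far[OF triple_uminus[OF t]] ac by auto
    qed
    ultimately have abc: "b = a + 1" "c = a + 2" by auto
    show False
    proof (cases "0 < a")
      case True
      then show False using nadj[of "nat a"] bds abc by (auto simp: descent_def algebra_simps)
    next
      case False
      then have "a \<le> - 3" using bds abc by auto
      then have e: "int (nat (- c)) = - c" "int (Suc (nat (- c))) = - b" "- c + 1 = - b" "- b + 1 = - a"
        "Suc (nat (- c)) < n"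
        using bds abc by auto
      have "descent f (nat (- c))" "descent f (Suc (nat (- c)))"
        unfolding descent_def e odd using bds by simp_all
      then show False using nadj e(5) by blast
    qed
  next
    case np: 2
    note bds = np[unfolded neg_pair_def]
    have broken2: "i = 0 \<and> j = 1 \<or> j = int i \<and> k = int i + 1" if i: "i < n" "descent f i" for i
    proof (rule ccontr)
      assume no: "\<not> ?thesis"
      have "neg_pair n (f \<circ> gen_perm i) (gen_perm i j) (gen_perm i k)"
        using neg_pair_gen_perm[OF np i(1)] no by blast
      then show False using neg i unfolding bad_def by blast
    qed
    \<comment> \<open>A descent below \<open>j\<close> must be at \<open>0\<close> with
      \<open>j = 1\<close>. A descent between \<open>j\<close> and \<open>k\<close> must then be at
      \<open>1\<close>, so the two are adjacent.\<close>
    obtain i where "i < n" "descent f i" "int i + 1 \<le> j"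
      using descent_between[of 0 j] bds by force
    then have *: "j = 1" "descent f 0" using broken2[of i] by auto
    obtain i where "i < n" "descent f i" "j \<le> int i"
      using descent_between[of j k] bds by force
    then show False using broken2[of i] * nadj[of 0] bds by auto
  qed
qed

end

section \<open>Reduced words\<close>

lemma val_0 [simp]: "val w 0 = 0"
  by (simp add: val_def)

lemma val_uminus: "val w (- p) = - val w p"
  by (simp add: val_def)

lemma val_gen_act_pos:
  assumes i: "i < length w" and p: "0 < p"
  shows "val (gen_act i w) p = val w (gen_perm i p)"
proof (cases "i = 0")
  case True
  show ?thesis
  proof (cases "p = 1")
    case False
    then have "nat p - 1 \<noteq> 0" using p by simp
    then show ?thesis using p False True by (simp add: val_def gen_act_def gen_perm_def)
  qed (use True i in \<open>simp add: val_def gen_act_def gen_perm_def\<close>)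
next
  case False
  then have ne: "i - 1 \<noteq> i" "nat (int i + 1) - 1 = i" by auto
  consider "p = int i" | "p = int i + 1"
    | "nat p - 1 \<noteq> i" "nat p - 1 \<noteq> i - 1" "p \<noteq> int i" "p \<noteq> int i + 1"
    using p by linarith
  then show ?thesis
  proof cases
    case 1
    then have "val w (gen_perm i p) = w ! i" using False ne by (simp add: gen_perm_def val_def)
    moreover have "val (gen_act i w) p = gen_act i w ! (i - 1)" using 1 False by (simp add: val_def)
    ultimately show ?thesis using False i ne by (simp add: gen_act_def)
  next
    case 2
    then have "val w (gen_perm i p) = w ! (i - 1)" using False by (simp add: gen_perm_def val_def)
    moreover have "val (gen_act i w) p = gen_act i w ! i" using 2 ne by (simp add: val_def)
    ultimately show ?thesis using False i by (simp add: gen_act_def)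
  next
    case 3
    then have "gen_perm i p = p" using False p by (simp add: gen_perm_def)
    then show ?thesis using 3 False p by (simp add: val_def gen_act_def)
  qed
qed

lemma val_gen_act:
  assumes "i < length w" shows "val (gen_act i w) = val w \<circ> gen_perm i"
proof
  fix p :: int
  consider "0 < p" | "p = 0" | "0 < - p" by linarith
  then show "val (gen_act i w) p = (val w \<circ> gen_perm i) p"
  proof cases
    case 2
    then show ?thesis by simp
  next
    case 3
    then show ?thesis using val_gen_act_pos[OF assms 3] by (simp add: val_uminus)
  qed (simp add: val_gen_act_pos[OF assms])
qed

lemma val_nth: "val w (int i + 1) = w ! i"
  by (simp add: val_def nat_add_distrib)

lemma val_inject: "val u = val w \<Longrightarrow> length u = length w \<Longrightarrow> u = w"
  by (rule nth_equalityI) (metis val_nth)+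

lemma length_gen_act [simp]: "length (gen_act i w) = length w"
  by (simp add: gen_act_def)

lemma gen_act_invol: "i < length w \<Longrightarrow> gen_act i (gen_act i w) = w"
  by (rule val_inject) (auto simp: val_gen_act)

lemma signed_perm_length: "signed_perm n w \<Longrightarrow> length w = n"
  by (simp add: signed_perm_def)

lemma signed_perm_gen_act:
  assumes "signed_perm n w" "i < n" shows "signed_perm n (gen_act i w)"
proof (cases "i = 0")
  case True
  have "map abs (w[0 := - (w ! 0)]) = map abs w"
    by (cases w) simp_all
  then show ?thesis using assms True by (simp add: signed_perm_def gen_act_def del: map_map)
next
  case False
  then have "set (gen_act i w) = set w"
    using assms by (simp add: gen_act_def signed_perm_def set_swap)
  then show ?thesis using assms by (simp add: signed_perm_def)
qed

lemma signed_perm_distinct: "signed_perm n w \<Longrightarrow> distinct (map abs w)"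
  unfolding signed_perm_def by (intro card_distinct) simp

lemma signed_perm_nth: "signed_perm n w \<Longrightarrow> i < n \<Longrightarrow> w ! i \<noteq> 0 \<and> \<bar>w ! i\<bar> \<le> int n"
proof -
  assume w: "signed_perm n w" "i < n"
  then have "map abs w ! i \<in> set (map abs w)" by (intro nth_mem) (simp add: signed_perm_def)
  also have "\<dots> = {1..int n}" using w by (simp only: signed_perm_def)
  finally show ?thesis using w by (auto simp: signed_perm_def)
qed

lemma signed_map_val:
  assumes w: "signed_perm n w" shows "signed_map n (val w)"
proof
  show odd: "val w (- p) = - val w p" for p by (simp add: val_def)
  fix p q assume b: "\<bar>p\<bar> \<le> int n" "\<bar>q\<bar> \<le> int n" "val w p = val w q"
  have nz: "val w r \<noteq> 0" if "\<bar>r\<bar> \<le> int n" "r \<noteq> 0" for r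
  proof -
    have "nat \<bar>r\<bar> - 1 < n" using that by linarith
    from signed_perm_nth[OF w this] show ?thesis using that by (auto simp: val_def)
  qed
  have abs: "\<bar>val w r\<bar> = map abs w ! (nat \<bar>r\<bar> - 1)" "nat \<bar>r\<bar> - 1 < length w"
    if "\<bar>r\<bar> \<le> int n" "r \<noteq> 0" for r
    using that signed_perm_length[OF w] by (auto simp: val_def)
  have "\<bar>p\<bar> = \<bar>q\<bar>" if "p \<noteq> 0" "q \<noteq> 0"
  proof -
    have "nat \<bar>p\<bar> - 1 = nat \<bar>q\<bar> - 1"
      using nth_eq_iff_index_eq[OF signed_perm_distinct[OF w]] abs[of p] abs[of q] b that by simp
    then show ?thesis using that by linarith
  qed
  moreover have "p \<noteq> - q \<or> p = 0 \<or> q = 0"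
    using b odd[of q] nz[of q] by (cases "q = 0") auto
  ultimately show "p = q" using b nz[of p] nz[of q] by (metis abs_eq_iff val_0)
qed

text \<open>The combinatorial length function of type B: inversions, pairs of entries with negative
  sum, and negative entries. It is identified with the Coxeter length in
  \<open>coxeter_length_eq\<close>.\<close>

fun sinv :: "int list \<Rightarrow> nat" where
  "sinv [] = 0"
| "sinv (x # xs) = length (filter (\<lambda>y. y < x) xs) + length (filter (\<lambda>y. x + y < 0) xs)
     + (if x < 0 then 1 else 0) + sinv xs"

lemma sinv_swap: "x < y \<Longrightarrow> sinv (as @ y # x # bs) = Suc (sinv (as @ x # y # bs))"
  by (induction as) (auto simp: add.commute)

text \<open>Negating the first entry interchanges the two counts taken against the remaining
  entries, so only the sign term changes.\<close>

lemma sinv_negate: "0 < x \<Longrightarrow> sinv (- x # xs) = Suc (sinv (x # xs))"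
proof -
  have "(\<lambda>y. y < - x) = (\<lambda>y. x + y < 0)" "(\<lambda>y. - x + y < 0) = (\<lambda>y. y < x)" by auto
  then show "0 < x \<Longrightarrow> ?thesis" by simp
qed

lemma sinv_descent:
  assumes w: "signed_perm n w" and i: "i < n" and d: "descent (val w) i"
  shows "sinv w = Suc (sinv (gen_act i w))"
proof (cases "i = 0")
  case True
  obtain x xs where xs: "w = x # xs" using w i by (cases w) (auto simp: signed_perm_def)
  then have "x < 0" using d True by (simp add: descent_def val_def)
  then show ?thesis using True xs sinv_negate[of "- x" xs] by (simp add: gen_act_def)
next
  case False
  have l: "length w = n" using w by (rule signed_perm_length)
  define as bs where "as = take (i - 1) w" and "bs = drop (Suc i) w"
  have "drop (i - 1) w = w ! (i - 1) # w ! i # bs"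
    using False i l Cons_nth_drop_Suc[of "i - 1" w] Cons_nth_drop_Suc[of i w] bs_def by simp
  then have wd: "w = as @ w ! (i - 1) # w ! i # bs" unfolding as_def by (metis append_take_drop_id)
  have la: "length as = i - 1" using as_def i l by simp
  have "gen_act i (as @ x # y # bs) = as @ y # x # bs" for x y
    using False la by (cases i) (simp_all add: gen_act_def nth_append list_update_append)
  then have g: "gen_act i w = as @ w ! i # w ! (i - 1) # bs" using wd by metis
  have "w ! i < w ! (i - 1)"
    using d val_nth[of w i] val_nth[of w "i - 1"] False by (simp add: descent_def of_nat_diff)
  then show ?thesis using sinv_swap[of "w ! i" "w ! (i - 1)" as bs] wd g by metis
qed

lemma descent_gen_act:
  assumes w: "signed_perm n w" and i: "i < n"
  shows "descent (val (gen_act i w)) i \<longleftrightarrow> \<not> descent (val w) i"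
proof -
  interpret signed_map n "val w" by (rule signed_map_val[OF w])
  have "val w (int i + 1) \<noteq> val w (int i)" "i = 0 \<Longrightarrow> val w 1 \<noteq> 0"
    using inj[of "int i + 1" "int i"] inj[of 1 0] i by auto
  then show ?thesis
    using odd[of 1] i signed_perm_length[OF w] by (auto simp: val_gen_act descent_def gen_perm_def)
qed

lemma sinv_ascent:
  assumes w: "signed_perm n w" and i: "i < n" and d: "\<not> descent (val w) i"
  shows "sinv (gen_act i w) = Suc (sinv w)"
  using sinv_descent[OF signed_perm_gen_act[OF w i] i] descent_gen_act[OF w i] d
    gen_act_invol[of i w] signed_perm_length[OF w] i by simp

lemma signed_perm_id: "signed_perm n (map int [1..<n + 1])"
proof -
  have "int ` {1..<n + 1} = {1..int n}"
    by (simp add: atLeastLessThanSuc_atLeastAtMost image_int_atLeastAtMost)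
  then show ?thesis by (simp add: signed_perm_def image_image del: upt_Suc)
qed

lemma sinv_sorted_pos: "sorted_wrt (<) xs \<Longrightarrow> \<forall>x\<in>set xs. 0 < x \<Longrightarrow> sinv xs = 0"
  by (induction xs) (auto simp: filter_empty_conv)

text \<open>Without descents the values at positions \<open>0, 1, ..., n\<close> increase from
  \<open>0\<close>. All entries are then positive and sorted, which leaves only the
  identity.\<close>

lemma no_descent_id:
  assumes w: "signed_perm n w" and nd: "\<And>i. i < n \<Longrightarrow> \<not> descent (val w) i"
  shows "w = map int [1..<n + 1]"
proof -
  interpret signed_map n "val w" by (rule signed_map_val[OF w])
  have l: "length w = n" by (rule signed_perm_length[OF w])
  have up: "val w p \<le> val w q" if "0 \<le> p" "p < q" "q \<le> int n" for p q
  proof (rule ccontr)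
    assume "\<not> ?thesis"
    then have "val w q < val w p" by simp
    moreover have "\<bar>p\<bar> \<le> int n" "\<bar>q\<bar> \<le> int n" using that by auto
    ultimately show False using descent_between[OF that(2)] nd by metis
  qed
  have pos: "0 < x" if "x \<in> set w" for x
  proof -
    from that obtain i where i: "i < n" "w ! i = x" unfolding in_set_conv_nth l by blast
    have "val w 0 \<le> val w (int i + 1)" by (rule up) (use i in auto)
    then have "0 \<le> x" using i by (simp add: val_nth)
    moreover have "x \<noteq> 0" using signed_perm_nth[OF w i(1)] i(2) by blast
    ultimately show ?thesis by simp
  qed
  have "sorted w"
    unfolding sorted_iff_nth_mono_less
  proof (intro allI impI)
    fix i j assume "i < j" "j < length w"
    then have "val w (int i + 1) \<le> val w (int j + 1)" by (intro up) (use l in auto)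
    then show "w ! i \<le> w ! j" by (simp add: val_nth)
  qed
  moreover have "map abs w = w" by (rule map_idI) (simp add: less_imp_le pos)
  ultimately have "sorted w" "distinct w" "set w = {1..int n}"
    using w signed_perm_distinct[OF w] by (simp_all add: signed_perm_def)
  moreover have "sorted (map int [1..<n + 1])" "distinct (map int [1..<n + 1])"
    by (auto simp: sorted_map distinct_map simp del: upt_Suc)
  moreover have "set (map int [1..<n + 1]) = {1..int n}"
  proof -
    have "map abs (map int [1..<n + 1]) = map int [1..<n + 1]" by (simp del: upt_Suc)
    then show ?thesis using signed_perm_id[of n] unfolding signed_perm_def by metis
  qed
  ultimately show ?thesis using sorted_distinct_set_unique by blast
qed

section \<open>Coxeter length and the last letters of reduced words\<close>

lemma is_word_signed_perm: "is_word n w us \<Longrightarrow> signed_perm n w"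
proof (induction us arbitrary: w rule: rev_induct)
  case Nil then show ?case using signed_perm_id[of n] by (simp add: is_word_def word_eval_def del: upt_Suc)
next
  case (snoc i us)
  then show ?case using signed_perm_gen_act[of n "word_eval n us" i]
    by (auto simp: is_word_def word_eval_def simp del: upt_Suc)
qed

lemma is_word_snoc:
  assumes w: "signed_perm n w"
  shows "is_word n w (us @ [i]) \<longleftrightarrow> i < n \<and> is_word n (gen_act i w) us"
proof -
  have "length (word_eval n us) = n" if "set us \<subseteq> {..<n}"
    using is_word_signed_perm[of n "word_eval n us" us] that by (simp add: is_word_def signed_perm_def)
  then show ?thesis using gen_act_invol[of i w] gen_act_invol[of i "word_eval n us"] signed_perm_length[OF w]
    by (auto simp: is_word_def word_eval_def)
qed

text \<open>Each letter changes \<open>sinv\<close> by exactly one, starting from \<open>0\<close>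
  at the identity.\<close>

lemma sinv_le_length: "is_word n w us \<Longrightarrow> sinv w \<le> length us"
proof (induction us arbitrary: w rule: rev_induct)
  case Nil
  then have "w = map int [1..<n + 1]" by (simp add: is_word_def word_eval_def)
  then show ?case by (auto simp: sorted_wrt_map intro!: sinv_sorted_pos simp del: upt_Suc)
next
  case (snoc i us)
  then have w: "signed_perm n w" by (simp add: is_word_signed_perm)
  then have i: "i < n" "sinv (gen_act i w) \<le> length us" using snoc is_word_snoc[OF w] by auto
  then show ?case using sinv_descent[OF w i(1)] sinv_ascent[OF w i(1)]
    by (cases "descent (val w) i") auto
qed

text \<open>Descents are undone one at a time, each lowering \<open>sinv\<close> by one, until none
  is left and the identity is reached.\<close>

lemma ex_word_length_sinv:
  "signed_perm n w \<Longrightarrow> \<exists>us. is_word n w us \<and> length us = sinv w"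
proof (induction "sinv w" arbitrary: w rule: less_induct)
  case less
  show ?case
  proof (cases "\<exists>i<n. descent (val w) i")
    case True
    then obtain i where i: "i < n" "descent (val w) i" by blast
    then obtain us where "is_word n (gen_act i w) us" "length us = sinv (gen_act i w)"
      using less.hyps[of "gen_act i w"] sinv_descent[OF less.prems i] signed_perm_gen_act[OF less.prems i(1)] by auto
    then have "is_word n w (us @ [i])" "length (us @ [i]) = sinv w"
      using is_word_snoc[OF less.prems] i sinv_descent[OF less.prems i] by auto
    then show ?thesis by blast
  next
    case False
    then have "is_word n w []"
      using no_descent_id[OF less.prems] by (simp add: is_word_def word_eval_def)
    then show ?thesis using sinv_le_length by fastforce
  qed
qed

lemma coxeter_length_eq: "signed_perm n w \<Longrightarrow> coxeter_length n w = sinv w"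
  unfolding coxeter_length_def
  by (rule Least_equality) (use ex_word_length_sinv sinv_le_length in blast)+

text \<open>The last letter is the last generator applied, and applying it again removes it. What
  remains is reduced exactly when this lowers \<open>sinv\<close>, that is, when the letter is a
  descent.\<close>

lemma reduced_word_snoc:
  assumes w: "signed_perm n w"
  shows "reduced_word n w (us @ [i]) \<longleftrightarrow>
    i < n \<and> descent (val w) i \<and> reduced_word n (gen_act i w) us"
proof (cases "i < n")
  case True
  note g = signed_perm_gen_act[OF w True]
  have "length us \<ge> sinv (gen_act i w)" if "is_word n (gen_act i w) us"
    using that by (rule sinv_le_length)
  then show ?thesis
    using True sinv_descent[OF w True] sinv_ascent[OF w True]
    by (cases "descent (val w) i")
       (auto simp: reduced_word_def is_word_snoc[OF w] coxeter_length_eq[OF w] coxeter_length_eq[OF g])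
qed (simp add: reduced_word_def is_word_snoc[OF w])

lemma ex_reduced_word: "signed_perm n w \<Longrightarrow> \<exists>us. reduced_word n w us"
  using ex_word_length_sinv by (auto simp: reduced_word_def coxeter_length_eq)

lemma reduced_word_length: "signed_perm n w \<Longrightarrow> reduced_word n w us \<Longrightarrow> length us = sinv w"
  by (simp add: reduced_word_def coxeter_length_eq)

section \<open>Commutation classes of reduced words\<close>

lemma comm_step_append: "comm_step u v \<Longrightarrow> comm_step (u @ z) (v @ z)"
  unfolding comm_step_def by (metis append_assoc)

lemma comm_steps_append: "comm_step\<^sup>*\<^sup>* u v \<Longrightarrow> comm_step\<^sup>*\<^sup>* (u @ z) (v @ z)"
  by (induction rule: rtranclp_induct) (auto intro: comm_step_append rtranclp.rtrancl_into_rtrancl)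

lemma gen_perm_commute:
  "i + 2 \<le> j \<Longrightarrow> gen_perm i (gen_perm j p) = gen_perm j (gen_perm i p)"
  by (cases "i = 0") (auto simp: gen_perm_def)

lemma gen_act_commute:
  assumes "i + 2 \<le> j \<or> j + 2 \<le> i" "i < length w" "j < length w"
  shows "gen_act i (gen_act j w) = gen_act j (gen_act i w)"
  using assms gen_perm_commute[of i j] gen_perm_commute[of j i]
  by (intro val_inject) (auto simp: val_gen_act fun_eq_iff)

lemma descent_gen_act_far:
  assumes "i + 2 \<le> j \<or> j + 2 \<le> i" "i < length w"
  shows "descent (val (gen_act i w)) j = descent (val w) j"
  using assms by (auto simp: val_gen_act descent_def gen_perm_def)

text \<open>Induction on the length, with the last letters \<open>i\<close> and \<open>j\<close> of
  the two words as descents. If they agree, the shorter words are connected; if they are adjacent,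
  \<open>w\<close> is bad. Otherwise both are routed through a common \<open>z\<close>:
  \<open>u\<close> to \<open>z @ [j, i]\<close> to \<open>z @ [i, j]\<close> to
  \<open>v\<close>.\<close>

lemma not_bad_connected:
  "signed_perm n w \<Longrightarrow> \<not> bad n (val w) \<Longrightarrow> reduced_word n w u \<Longrightarrow> reduced_word n w v \<Longrightarrow>
   comm_step\<^sup>*\<^sup>* u v"
proof (induction "sinv w" arbitrary: w u v rule: less_induct)
  case less
  note w = less.prems(1)
  interpret signed_map n "val w" by (rule signed_map_val[OF w])
  have len: "length w = n" by (rule signed_perm_length[OF w])
  have down: "comm_step\<^sup>*\<^sup>* x y"
    if "i < n" "descent (val w) i" "reduced_word n (gen_act i w) x" "reduced_word n (gen_act i w) y" for i x y
  proof (rule less.hyps[OF _ _ _ that(3,4)])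
    show "sinv (gen_act i w) < sinv w" using sinv_descent[OF w that(1,2)] by simp
    show "signed_perm n (gen_act i w)" using signed_perm_gen_act[OF w that(1)] .
    show "\<not> bad n (val (gen_act i w))"
      using bad_weak_order[OF that(1,2)] less.prems(2) that(1) len by (auto simp: val_gen_act)
  qed
  have l: "length u = length v" using less.prems reduced_word_length[OF w] by simp
  show ?case
  proof (cases u rule: rev_cases)
    case Nil then show ?thesis using l by simp
  next
    case u: (snoc u' i)
    then obtain v' j where v: "v = v' @ [j]" using l by (cases v rule: rev_cases) auto
    have i: "i < n" "descent (val w) i" "reduced_word n (gen_act i w) u'"
      using less.prems(3) reduced_word_snoc[OF w] u by auto
    have j: "j < n" "descent (val w) j" "reduced_word n (gen_act j w) v'"
      using less.prems(4) reduced_word_snoc[OF w] v by auto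
    consider "i = j" | "j = Suc i" | "i = Suc j" | "i + 2 \<le> j \<or> j + 2 \<le> i" by linarith
    then show ?thesis
    proof cases
      case 1
      then show ?thesis using down[OF i(1,2,3)] j u v by (auto intro: comm_steps_append)
    next
      case 2 then show ?thesis using adjacent_descents_bad[of i] i j less.prems(2) by auto
    next
      case 3 then show ?thesis using adjacent_descents_bad[of j] i j less.prems(2) by auto
    next
      case far: 4
      note wi = signed_perm_gen_act[OF w i(1)] and wj = signed_perm_gen_act[OF w j(1)]
      have comm: "gen_act i (gen_act j w) = gen_act j (gen_act i w)"
        using gen_act_commute[of i j w] far i j len by auto
      \<comment> \<open>Far apart descents do not affect each other, so \<open>z\<close> extends to
        reduced words of \<open>w\<close> ending in \<open>j, i\<close> and in
        \<open>i, j\<close>.\<close>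
      obtain z where z: "reduced_word n (gen_act j (gen_act i w)) z"
        using ex_reduced_word signed_perm_gen_act[OF wi j(1)] by blast
      have "reduced_word n (gen_act i w) (z @ [j])"
        using z reduced_word_snoc[OF wi] j descent_gen_act_far[of i j w] far i len by auto
      then have "comm_step\<^sup>*\<^sup>* u' (z @ [j])" using down[OF i] by blast
      then have "comm_step\<^sup>*\<^sup>* u (z @ [j, i])" using comm_steps_append[of u' "z @ [j]" "[i]"] u by simp
      also have "comm_step (z @ [j, i]) (z @ [i, j])"
        using far unfolding comm_step_def by (metis append_Nil2)
      also have "reduced_word n (gen_act j w) (z @ [i])"
        using z reduced_word_snoc[OF wj] i descent_gen_act_far[of j i w] far j len comm by auto
      then have "comm_step\<^sup>*\<^sup>* (z @ [i]) v'" using down[OF j(1,2) _ j(3)] by blast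
      then have "comm_step\<^sup>*\<^sup>* (z @ [i, j]) v" using comm_steps_append[of "z @ [i]" v' "[j]"] v by simp
      finally show ?thesis by simp
    qed
  qed
qed

text \<open>The factors \<open>r\<close> and \<open>s\<close> will be the two sides of a long braid
  relation. The condition on filtered words is what \<open>comm_steps_filter\<close> shows to be an
  obstruction to commutation equivalence.\<close>

definition two_braid_words :: "nat \<Rightarrow> int list \<Rightarrow> bool" where
  "two_braid_words n w \<longleftrightarrow> (\<exists>x y i r s. reduced_word n w (x @ r @ y) \<and> reduced_word n w (x @ s @ y) \<and>
     filter (\<lambda>k. k = i \<or> k = Suc i) r \<noteq> filter (\<lambda>k. k = i \<or> k = Suc i) s)"

lemma gen_perm_braid3:
  assumes "i \<noteq> 0"
  shows "gen_perm i (gen_perm (Suc i) (gen_perm i p)) = gen_perm (Suc i) (gen_perm i (gen_perm (Suc i) p))"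
proof -
  have pos: "gen_perm i (gen_perm (Suc i) (gen_perm i p)) = gen_perm (Suc i) (gen_perm i (gen_perm (Suc i) p))"
    if "0 \<le> p" for p
  proof -
    consider "p = int i" | "p = int i + 1" | "p = int i + 2"
      | "p \<noteq> int i" "p \<noteq> int i + 1" "p \<noteq> int i + 2" by blast
    then show ?thesis
    proof cases
      case 4
      then have "gen_perm i p = p" "gen_perm (Suc i) p = p" using assms that by (simp_all add: gen_perm_def)
      then show ?thesis by simp
    qed (use assms in \<open>simp_all add: gen_perm_def\<close>)
  qed
  show ?thesis using pos[of p] pos[of "- p"] by (cases "0 \<le> p") auto
qed

lemma gen_perm_braid4:
  "gen_perm 0 (gen_perm 1 (gen_perm 0 (gen_perm 1 p))) = gen_perm 1 (gen_perm 0 (gen_perm 1 (gen_perm 0 p)))"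
proof -
  consider "p = 1" | "p = 2" | "p = -1" | "p = -2" | "\<bar>p\<bar> \<noteq> 1" "\<bar>p\<bar> \<noteq> 2" by linarith
  then show ?thesis
  proof cases
    case 5
    then have "gen_perm 0 p = p" "gen_perm 1 p = p" by (auto simp: gen_perm_def)
    then show ?thesis by simp
  qed (simp_all add: gen_perm_def)
qed

text \<open>If both generators of a dihedral parabolic subgroup are descents, its longest element
  can be stripped off the right of \<open>w\<close>. Its two reduced words \<open>i, i+1, i\<close>
  and \<open>i+1, i, i+1\<close> then follow the same reduced word \<open>z\<close> of the stripped
  element.\<close>

lemma adjacent_descents_braid3:
  assumes w: "signed_perm n w" and i: "i \<noteq> 0" "Suc i < n" "descent (val w) i" "descent (val w) (Suc i)"
  shows "two_braid_words n w"
proof -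
  let ?a = "gen_act i" and ?b = "gen_act (Suc i)" and ?f = "val w"
  have n: "i < n" "Suc i < n" using i by auto
  have len: "i < length w" "Suc i < length w" using n signed_perm_length[OF w] by auto
  have d: "?f (int i + 1) < ?f (int i)" "?f (int i + 2) < ?f (int i + 1)"
    using i by (simp_all add: descent_def add.commute)
  have gp: "gen_perm i (int i) = int i + 1" "gen_perm i (int i + 1) = int i"
    "gen_perm i (int i + 2) = int i + 2" "gen_perm (Suc i) (int i) = int i"
    "gen_perm (Suc i) (int i + 1) = int i + 2" "gen_perm (Suc i) (int i + 2) = int i + 1"
    using i by (simp_all add: gen_perm_def)
  have dsc: "descent f i \<longleftrightarrow> f (int i + 1) < f (int i)"
    "descent f (Suc i) \<longleftrightarrow> f (int i + 2) < f (int i + 1)" for f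
    by (simp_all add: descent_def add.commute)
  have sa: "signed_perm n u \<Longrightarrow> signed_perm n (?a u)" and sb: "signed_perm n u \<Longrightarrow> signed_perm n (?b u)" for u
    using signed_perm_gen_act n by blast+
  have eq: "?a (?b (?a w)) = ?b (?a (?b w))"
    using len gen_perm_braid3[OF i(1)] by (intro val_inject) (simp_all add: val_gen_act fun_eq_iff)
  obtain z where z: "reduced_word n (?a (?b (?a w))) z"
    using ex_reduced_word sa[OF sb[OF sa[OF w]]] by blast
  have "descent (val (?a w)) (Suc i)" "descent (val (?b (?a w))) i"
    "descent (val (?b w)) i" "descent (val (?a (?b w))) (Suc i)"
    using d len by (simp_all add: dsc val_gen_act gp)
  then have "reduced_word n w (((z @ [i]) @ [Suc i]) @ [i])"
    and "reduced_word n w (((z @ [Suc i]) @ [i]) @ [Suc i])"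
    using z i n eq w sa sb by (simp_all only: reduced_word_snoc)
  then have "reduced_word n w (z @ [i, Suc i, i] @ [])" "reduced_word n w (z @ [Suc i, i, Suc i] @ [])"
    by simp_all
  then show ?thesis unfolding two_braid_words_def
    by (intro exI[of _ z] exI[of _ "[]"] exI[of _ i] exI[of _ "[i, Suc i, i]"] exI[of _ "[Suc i, i, Suc i]"]) simp
qed

text \<open>The case of \<open>s_0\<close> and \<open>s_1\<close>, whose dihedral group has a
  longest element of length four.\<close>

lemma adjacent_descents_braid4:
  assumes w: "signed_perm n w" and i: "1 < n" "descent (val w) 0" "descent (val w) 1"
  shows "two_braid_words n w"
proof -
  let ?a = "gen_act 0" and ?b = "gen_act 1" and ?f = "val w"
  have n: "0 < n" "1 < n" using i by auto
  have len: "0 < length w" "1 < length w" using n signed_perm_length[OF w] by auto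
  have d: "?f 1 < 0" "?f 2 < ?f 1" using i by (simp_all add: descent_def)
  have gp: "gen_perm 0 1 = -1" "gen_perm 0 2 = 2" "gen_perm 1 1 = 2" "gen_perm 1 2 = 1"
    by (simp_all add: gen_perm_def)
  have dsc: "descent f 0 \<longleftrightarrow> f 1 < f 0" "descent f 1 \<longleftrightarrow> f 2 < f 1" for f
    by (simp_all add: descent_def)
  have sa: "signed_perm n u \<Longrightarrow> signed_perm n (?a u)" and sb: "signed_perm n u \<Longrightarrow> signed_perm n (?b u)" for u
    using signed_perm_gen_act n by blast+
  have eq: "?b (?a (?b (?a w))) = ?a (?b (?a (?b w)))"
    using len gen_perm_braid4 by (intro val_inject) (simp_all only: val_gen_act length_gen_act fun_eq_iff o_apply simp_thms)
  obtain z where z: "reduced_word n (?b (?a (?b (?a w)))) z"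
    using ex_reduced_word sb[OF sa[OF sb[OF sa[OF w]]]] by blast
  have "val (?a w) = ?f \<circ> gen_perm 0" "val (?b (?a w)) = ?f \<circ> gen_perm 0 \<circ> gen_perm 1"
    "val (?a (?b (?a w))) = ?f \<circ> gen_perm 0 \<circ> gen_perm 1 \<circ> gen_perm 0"
    "val (?b w) = ?f \<circ> gen_perm 1" "val (?a (?b w)) = ?f \<circ> gen_perm 1 \<circ> gen_perm 0"
    "val (?b (?a (?b w))) = ?f \<circ> gen_perm 1 \<circ> gen_perm 0 \<circ> gen_perm 1"
    using len by (simp_all only: val_gen_act length_gen_act)
  then have "descent (val (?a w)) 1" "descent (val (?b (?a w))) 0" "descent (val (?a (?b (?a w)))) 1"
    "descent (val (?b w)) 0" "descent (val (?a (?b w))) 1" "descent (val (?b (?a (?b w)))) 0"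
    using d by (simp_all only: dsc o_apply gp gen_perm_uminus gen_perm_zero val_uminus val_0)
  then have "reduced_word n w ((((z @ [1]) @ [0]) @ [1]) @ [0])"
    and "reduced_word n w ((((z @ [0]) @ [1]) @ [0]) @ [1])"
    using z i n eq w sa sb by (simp_all only: reduced_word_snoc simp_thms)
  then have "reduced_word n w (z @ [1, 0, 1, 0] @ [])" "reduced_word n w (z @ [0, 1, 0, 1] @ [])"
    by simp_all
  then show ?thesis unfolding two_braid_words_def
    by (intro exI[of _ z] exI[of _ "[]"] exI[of _ 0] exI[of _ "[1, 0, 1, 0]"] exI[of _ "[0, 1, 0, 1]"]) simp
qed

text \<open>\<open>bad_descend\<close> leads down through bad elements until two adjacent descents
  occur. On the way back up, the removed letters are appended to \<open>y\<close> and leave the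
  braid factor untouched.\<close>

lemma bad_braid: "signed_perm n w \<Longrightarrow> bad n (val w) \<Longrightarrow> two_braid_words n w"
proof (induction "sinv w" arbitrary: w rule: less_induct)
  case less
  note w = less.prems(1)
  interpret signed_map n "val w" by (rule signed_map_val[OF w])
  from bad_descend[OF less.prems(2)] show ?case
  proof (elim disjE exE conjE)
    fix i assume "Suc i < n" "descent (val w) i" "descent (val w) (Suc i)"
    then show ?thesis
      using adjacent_descents_braid3[OF w] adjacent_descents_braid4[OF w] by (cases "i = 0") auto
  next
    fix i assume i: "i < n" "descent (val w) i" "bad n (val w \<circ> gen_perm i)"
    have "bad n (val (gen_act i w))" using i signed_perm_length[OF w] by (simp add: val_gen_act)
    then have "two_braid_words n (gen_act i w)"
      using less.hyps[of "gen_act i w"] sinv_descent[OF w i(1,2)] signed_perm_gen_act[OF w i(1)] by simp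
    then obtain x y k r s where "reduced_word n (gen_act i w) (x @ r @ y)"
      "reduced_word n (gen_act i w) (x @ s @ y)"
      and f: "filter (\<lambda>l. l = k \<or> l = Suc k) r \<noteq> filter (\<lambda>l. l = k \<or> l = Suc k) s"
      unfolding two_braid_words_def by blast
    then have "reduced_word n w (x @ r @ (y @ [i]))" "reduced_word n w (x @ s @ (y @ [i]))"
      using reduced_word_snoc[OF w, of "x @ r @ y" i] reduced_word_snoc[OF w, of "x @ s @ y" i] i by simp_all
    then show ?thesis using f unfolding two_braid_words_def by blast
  qed
qed

text \<open>The subword on two adjacent generators is invariant under commutations; the plain letter
  count would not separate \<open>0101\<close> from \<open>1010\<close>.\<close>

lemma comm_steps_filter:
  "comm_step\<^sup>*\<^sup>* u v \<Longrightarrow> filter (\<lambda>k. k = i \<or> k = Suc i) u = filter (\<lambda>k. k = i \<or> k = Suc i) v"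
proof (induction rule: rtranclp_induct)
  case (step v v')
  then show ?case by (auto simp: comm_step_def)
qed simp

theorem fully_commutative_iff_not_bad:
  assumes "signed_perm n w"
  shows "fully_commutative n w \<longleftrightarrow> \<not> bad n (val w)"
proof
  assume fc: "fully_commutative n w"
  show "\<not> bad n (val w)"
  proof
    assume "bad n (val w)"
    then obtain x y i r s where "reduced_word n w (x @ r @ y)" "reduced_word n w (x @ s @ y)"
      and f: "filter (\<lambda>k. k = i \<or> k = Suc i) r \<noteq> filter (\<lambda>k. k = i \<or> k = Suc i) s"
      using bad_braid[OF assms] unfolding two_braid_words_def by blast
    then have "comm_step\<^sup>*\<^sup>* (x @ r @ y) (x @ s @ y)" using fc unfolding fully_commutative_def by blast
    then show False using comm_steps_filter[of _ _ i] f by fastforce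
  qed
next
  assume "\<not> bad n (val w)"
  then show "fully_commutative n w"
    using not_bad_connected[OF assms] unfolding fully_commutative_def by blast
qed

section \<open>Increasing subsequences of symmetric sequences\<close>

context signed_map
begin

definition positions :: "int set" where
  "positions = {p. p \<noteq> 0 \<and> \<bar>p\<bar> \<le> int n}"

text \<open>Subsequences are sets of positions here; \<open>chain_image\<close> and
  \<open>chain_preimage\<close> translate to the value sets of \<open>chain\<close>.\<close>

definition increasing :: "int set \<Rightarrow> bool" where
  "increasing I \<longleftrightarrow> I \<subseteq> positions \<and> (\<forall>p\<in>I. \<forall>q\<in>I. p < q \<longrightarrow> f p < f q)"

text \<open>In contrast to \<open>triple\<close>, opposite positions are allowed.\<close>

definition dec3 :: "int \<Rightarrow> int \<Rightarrow> int \<Rightarrow> bool" where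
  "dec3 a b c \<longleftrightarrow> a < b \<and> b < c \<and> f b < f a \<and> f c < f b"

lemma finite_positions: "finite positions"
proof -
  have "positions \<subseteq> {- int n..int n}" by (auto simp: positions_def)
  then show ?thesis using finite_subset by blast
qed

lemma card_positions: "card positions = 2 * n"
proof -
  have "positions = {- int n..int n} - {0}" by (auto simp: positions_def)
  then show ?thesis by simp
qed

lemma increasing_finite: "increasing I \<Longrightarrow> finite I"
  unfolding increasing_def using finite_positions finite_subset by blast

lemma inj_on_positions: "inj_on f positions"
  by (auto simp: inj_on_def positions_def intro: inj)

lemma f_nonzero: "p \<in> positions \<Longrightarrow> f p \<noteq> 0"
  using inj[of p 0] by (auto simp: positions_def)

lemma positions_uminus [simp]: "- p \<in> positions \<longleftrightarrow> p \<in> positions"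
  by (auto simp: positions_def)

lemma increasing_uminus: "increasing I \<Longrightarrow> increasing (uminus ` I)"
  by (auto simp: increasing_def odd)

text \<open>The cover consists of the left-to-right maxima and of the rest.\<close>

lemma cover_by_increasing:
  assumes S: "S \<subseteq> positions" and no: "\<And>a b c. a \<in> S \<Longrightarrow> b \<in> S \<Longrightarrow> c \<in> S \<Longrightarrow> \<not> dec3 a b c"
  shows "\<exists>I J. increasing I \<and> increasing J \<and> I \<union> J = S"
proof -
  define I where "I = {p \<in> S. \<forall>q\<in>S. q < p \<longrightarrow> f q < f p}"
  have IS: "I \<subseteq> S" by (auto simp: I_def)
  have neq: "f p \<noteq> f q" if "p \<in> S" "q \<in> S" "p < q" for p q
    using inj_onD[OF inj_on_positions, of p q] that S by blast
  have "increasing I" unfolding increasing_def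
  proof (intro conjI ballI impI)
    fix p q assume "p \<in> I" "q \<in> I" "p < q"
    then show "f p < f q" unfolding I_def by blast
  qed (use S IS in blast)
  moreover have "increasing (S - I)" unfolding increasing_def
  proof (intro conjI ballI impI)
    fix p q assume p: "p \<in> S - I" and q: "q \<in> S - I" and pq: "p < q"
    then obtain r where r: "r \<in> S" "r < p" "\<not> f r < f p" unfolding I_def by blast
    then have rp: "f p < f r" using neq[of r p] p by simp
    show "f p < f q"
    proof (rule ccontr)
      assume "\<not> ?thesis"
      then have "f q < f p" using neq[of p q] p q pq by simp
      then have "dec3 r p q" using r pq rp by (simp add: dec3_def)
      then show False using no[of r p q] r p q by blast
    qed
  qed (use S in blast)
  moreover have "I \<union> (S - I) = S" using IS by blast
  ultimately show ?thesis by blast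
qed

lemma increasing_no_descent: "increasing K \<Longrightarrow> x < y \<Longrightarrow> f y < f x \<Longrightarrow> x \<in> K \<Longrightarrow> y \<notin> K"
  unfolding increasing_def using less_asym by blast

text \<open>By the pigeonhole principle one of the two sets would contain two of the three
  positions.\<close>

lemma dec3_increasing:
  assumes "dec3 a b c" and I: "increasing I" and J: "increasing J"
  shows "\<not> {a, b, c} \<subseteq> I \<union> J"
proof -
  have "a < b" "b < c" "a < c" "f b < f a" "f c < f b" "f c < f a"
    using assms(1) by (auto simp: dec3_def)
  note this(1,4) this(2,5) this(3,6)
  note p = increasing_no_descent[OF _ this(1,2)] increasing_no_descent[OF _ this(3,4)]
    increasing_no_descent[OF _ this(5,6)]
  show ?thesis using p[OF I] p[OF J] by blast
qed

text \<open>If at most one position were missed, it would lie in every decreasing triple. But a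
  triple with distinct absolute values is disjoint from its mirror image, and a negative pair makes
  \<open>f\<close> decrease along \<open>- k, - j, j, k\<close>, whose four subtriples have no
  common position.\<close>

lemma bad_no_cover:
  assumes "bad n f" and I: "increasing I" and J: "increasing J"
  shows "card (I \<union> J) + 1 < 2 * n"
proof (rule ccontr)
  assume no: "\<not> ?thesis"
  have IJ: "I \<union> J \<subseteq> positions" using I J by (simp add: increasing_def)
  have "card (positions - (I \<union> J)) = 2 * n - card (I \<union> J)"
    using card_Diff_subset[OF finite_subset[OF IJ finite_positions] IJ] card_positions by simp
  then have c: "card (positions - (I \<union> J)) \<le> Suc 0" using no by linarith
  have one: "x = y" if "x \<in> positions" "x \<notin> I \<union> J" "y \<in> positions" "y \<notin> I \<union> J" for x y
    using c that card_le_Suc0_iff_eq[OF finite_Diff[OF finite_positions], of "I \<union> J"] by blast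
  from assms(1) consider a b c where "triple n f a b c" | j k where "neg_pair n f j k"
    unfolding bad_def by blast
  then show False
  proof cases
    case 1
    then have d: "dec3 a b c" "dec3 (- c) (- b) (- a)" unfolding triple_def dec3_def odd by simp_all
    have p: "{a, b, c} \<subseteq> positions" "{- c, - b, - a} \<subseteq> positions"
      using 1 by (simp_all add: triple_def positions_def)
    obtain x y where x: "x \<in> {a, b, c}" "x \<notin> I \<union> J" and y: "y \<in> {- c, - b, - a}" "y \<notin> I \<union> J"
      using dec3_increasing[OF d(1) I J] dec3_increasing[OF d(2) I J] by blast
    have "x = y" using one x y p by blast
    then have "\<bar>x\<bar> \<in> {\<bar>a\<bar>, \<bar>b\<bar>, \<bar>c\<bar>}" "x \<in> {- c, - b, - a}" "x \<in> {a, b, c}" using x y by auto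
    moreover have "\<bar>a\<bar> \<noteq> \<bar>b\<bar>" "\<bar>b\<bar> \<noteq> \<bar>c\<bar>" "\<bar>a\<bar> \<noteq> \<bar>c\<bar>" "a \<noteq> 0" "b \<noteq> 0" "c \<noteq> 0"
      using 1 by (simp_all add: triple_def)
    ultimately show False by auto
  next
    case 2
    then have d: "dec3 (- k) (- j) j" "dec3 (- k) (- j) k" "dec3 (- k) j k" "dec3 (- j) j k"
      unfolding neg_pair_def dec3_def odd by simp_all
    have p: "{- k, - j, j, k} \<subseteq> positions" and ne: "0 < j" "j < k"
      using 2 by (simp_all add: neg_pair_def positions_def)
    obtain x where x: "x \<in> {- k, - j, j}" "x \<notin> I \<union> J"
      using dec3_increasing[OF d(1) I J] by blast
    have "x \<in> S" if S: "\<not> S \<subseteq> I \<union> J" "S \<subseteq> {- k, - j, j, k}" for S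
    proof -
      obtain y where y: "y \<in> S" "y \<notin> I \<union> J" using S(1) by blast
      have "x \<in> positions" "y \<in> positions" using x(1) y(1) p S(2) by auto
      then show ?thesis using one[of x y] x(2) y by simp
    qed
    note this[OF dec3_increasing[OF d(2) I J]] this[OF dec3_increasing[OF d(3) I J]]
      this[OF dec3_increasing[OF d(4) I J]]
    then have "x \<in> {- k, - j, k}" "x \<in> {- k, j, k}" "x \<in> {- j, j, k}" by simp_all
    then show False using x(1) ne by auto
  qed
qed

text \<open>A position \<open>p > 0\<close> with a negative value and an entry \<open>j\<close> between \<open>- p\<close> and \<open>p\<close>
  completing it to the decreasing triples \<open>- p, j, p\<close> and \<open>- p, - j, p\<close>.\<close>

definition pivot :: "int \<Rightarrow> int \<Rightarrow> bool" where
  "pivot p j \<longleftrightarrow> 0 < j \<and> j < p \<and> p \<le> int n \<and> f p < 0 \<and> 0 < f j \<and> f j < - f p"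

text \<open>As the positions do not form a \<open>triple\<close>, two of them are opposite. If these
  are neighbours in the triple, they produce a negative pair together with the third, so it is the
  outer two, and the middle one supplies \<open>j\<close>.\<close>

lemma dec3_pivot:
  assumes nb: "\<not> bad n f" and pos: "a \<in> positions" "b \<in> positions" "c \<in> positions" and d: "dec3 a b c"
  shows "a = - c \<and> pivot c \<bar>b\<bar>"
proof -
  have no: "\<not> neg_pair n f j k" for j k using nb by (auto simp: bad_def)
  have d': "a < b" "b < c" "f b < f a" "f c < f b" using d by (auto simp: dec3_def)
  have nz: "f a \<noteq> 0" "f b \<noteq> 0" "f c \<noteq> 0" using pos f_nonzero by auto
  have "\<not> triple n f a b c" using nb by (auto simp: bad_def)
  then consider "a = - b" | "b = - c" | "a = - c"
    using pos d' by (force simp: triple_def positions_def abs_eq_iff)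
  then show ?thesis
  proof cases
    case 1
    then have "f a = - f b" by (simp add: odd)
    then have "neg_pair n f b c" using 1 d' pos by (auto simp: neg_pair_def positions_def)
    then show ?thesis using no by blast
  next
    case 2
    then have "f b = - f c" "f (- a) = - f a" by (simp_all add: odd)
    then have "neg_pair n f c (- a)" using 2 d' pos by (auto simp: neg_pair_def positions_def)
    then show ?thesis using no by blast
  next
    case 3
    have fa: "f a = - f c" "f (- b) = - f b" using 3 by (simp_all add: odd)
    have c: "0 < c" "c \<le> int n" "f c < 0" "\<bar>b\<bar> < c" using 3 d' pos fa by (auto simp: positions_def)
    have "0 < f \<bar>b\<bar>"
    proof (rule ccontr)
      assume "\<not> ?thesis"
      then have "f \<bar>b\<bar> < 0" "f c < f \<bar>b\<bar>" using nz fa d' by (auto simp: abs_if split: if_splits)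
      then have "neg_pair n f \<bar>b\<bar> c" using c pos by (auto simp: neg_pair_def positions_def)
      then show False using no by blast
    qed
    moreover have "f \<bar>b\<bar> < - f c" using fa d' by (auto simp: abs_if)
    ultimately show ?thesis using 3 c pos by (auto simp: pivot_def positions_def)
  qed
qed

text \<open>A second negative value at \<open>q > p\<close> gives the triple
  \<open>- p, j, q\<close>. At \<open>q < p\<close> it gives either the negative pair
  \<open>q, p\<close> or the triple \<open>- q, j, p\<close>.\<close>

lemma pivot_unique:
  assumes nb: "\<not> bad n f" and pv: "pivot p j" and q: "0 < q" "q \<le> int n" "q \<noteq> p"
  shows "0 < f q"
proof (rule ccontr)
  assume "\<not> ?thesis"
  moreover have "f q \<noteq> 0" using f_nonzero[of q] q by (auto simp: positions_def)
  ultimately have fq: "f q < 0" by simp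
  have p: "0 < j" "j < p" "p \<le> int n" "f p < 0" "0 < f j" "f j < - f p" using pv by (auto simp: pivot_def)
  have jq: "j \<noteq> q" using fq p by auto
  show False
  proof (cases "q < p")
    case True
    have "\<not> f p < f q" using nb True q fq p by (auto simp: bad_def neg_pair_def)
    then have "triple n f (- q) j p" using True q fq p jq by (auto simp: triple_def odd)
    then show False using nb by (auto simp: bad_def)
  next
    case False
    then have "triple n f (- p) j q" using q fq p jq by (auto simp: triple_def odd)
    then show False using nb by (auto simp: bad_def)
  qed
qed

lemma not_bad_cover:
  assumes nb: "\<not> bad n f"
  shows "(\<exists>I J. increasing I \<and> increasing J \<and> card (I \<union> J) = 2 * n) \<or>
    (\<exists>p j. pivot p j) \<and> (\<exists>I J. increasing I \<and> increasing J \<and> card (I \<union> J) + 1 = 2 * n)"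
proof (cases "\<exists>p j. pivot p j")
  case False
  then have "\<not> dec3 a b c" if "a \<in> positions" "b \<in> positions" "c \<in> positions" for a b c
    using dec3_pivot[OF nb that] by blast
  then obtain I J where IJ: "increasing I" "increasing J" "I \<union> J = positions"
    using cover_by_increasing[OF subset_refl] by blast
  then have "card (I \<union> J) = 2 * n" using card_positions by simp
  then show ?thesis using IJ(1,2) by blast
next
  case True
  then obtain p j where pv: "pivot p j" by blast
  then have p: "p \<in> positions" by (auto simp: pivot_def positions_def)
  \<comment> \<open>A decreasing triple ends at a pivot, and \<open>p\<close> is the only positive
    position with a negative value.\<close>
  have "\<not> dec3 a b c" if "a \<in> positions - {p}" "b \<in> positions - {p}" "c \<in> positions - {p}" for a b c
  proof
    assume "dec3 a b c"
    then have "pivot c \<bar>b\<bar>" using dec3_pivot[OF nb] that by blast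
    then have "0 < c" "c \<le> int n" "f c < 0" unfolding pivot_def by linarith+
    then show False using pivot_unique[OF nb pv, of c] that by simp
  qed
  then obtain I J where IJ: "increasing I" "increasing J" "I \<union> J = positions - {p}"
    using cover_by_increasing[OF Diff_subset] by blast
  then have "card (I \<union> J) + 1 = 2 * n"
    using card.remove[OF finite_positions p] card_positions by simp
  then show ?thesis using IJ(1,2) True by blast
qed

section \<open>Parity of the longest increasing subsequence\<close>

lemma increasing_symmetrize:
  assumes C: "increasing C" and pos: "\<And>c. c \<in> C \<Longrightarrow> 0 < c \<and> 0 < f c"
  shows "increasing (C \<union> uminus ` C) \<and> card (C \<union> uminus ` C) = 2 * card C"
proof
  have m: "f (- c) < f d" "\<not> d < - c" if "c \<in> C" "d \<in> C" for c d
    using pos[OF that(1)] pos[OF that(2)] odd[of c] by linarith+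
  have "f x < f y" if x: "x \<in> C \<union> uminus ` C" and y: "y \<in> C \<union> uminus ` C" and xy: "x < y" for x y
  proof -
    consider "x \<in> C" "y \<in> C" | "x \<in> uminus ` C" "y \<in> uminus ` C"
      | c where "x = - c" "c \<in> C" "y \<in> C" | d where "x \<in> C" "y = - d" "d \<in> C"
      using x y by blast
    then show ?thesis
    proof cases
      case 1 then show ?thesis using C xy unfolding increasing_def by blast
    next
      case 2 then show ?thesis using increasing_uminus[OF C] xy unfolding increasing_def by blast
    next
      case 3 then show ?thesis using m(1) by simp
    next
      case 4 then show ?thesis using m(2)[of d x] xy by simp
    qed
  qed
  moreover have "C \<union> uminus ` C \<subseteq> positions"
    using C increasing_uminus[OF C] by (simp add: increasing_def)
  ultimately show "increasing (C \<union> uminus ` C)" by (simp add: increasing_def)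
  have ne: "c \<noteq> - d" if "c \<in> C" "d \<in> C" for c d
    using pos[OF that(1)] pos[OF that(2)] by linarith
  have "C \<inter> uminus ` C = {}"
  proof (rule equals0I)
    fix x assume "x \<in> C \<inter> uminus ` C"
    then obtain d where "x \<in> C" "d \<in> C" "x = - d" by auto
    then show False using ne by blast
  qed
  moreover have "card (uminus ` C) = card C" by (simp add: card_image)
  ultimately show "card (C \<union> uminus ` C) = 2 * card C"
    using increasing_finite[OF C] by (simp add: card_Un_disjoint)
qed

text \<open>A longest increasing set avoiding \<open>p\<close> and \<open>- p\<close> is no longer than the symmetrization of its
  positive or negative half. If it contains \<open>p\<close>, then \<open>j\<close> can be added to both halves, and one of
  the two symmetrizations is longer than the set itself.\<close>

lemma even_maximal:
  assumes nb: "\<not> bad n f" and pv: "pivot p j" and I0: "increasing I0"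
    and mx: "\<And>K. increasing K \<Longrightarrow> card K \<le> card I0"
  shows "even (card I0)"
proof -
  have p: "0 < j" "j < p" "p \<le> int n" "f p < 0" "0 < f j" "f j < - f p" using pv by (auto simp: pivot_def)
  have jp: "j \<in> positions" using p by (auto simp: positions_def)
  \<comment> \<open>An increasing set cannot contain both \<open>- p\<close> and \<open>p\<close>,
    since \<open>f (- p) > f p\<close>. If it contains \<open>- p\<close>, its mirror image does
    not.\<close>
  have "\<exists>I. increasing I \<and> card I = card I0 \<and> - p \<notin> I"
  proof (cases "- p \<in> I0")
    case True
    then have "p \<notin> I0" using I0 p odd[of p] unfolding increasing_def by fastforce
    then have "- p \<notin> uminus ` I0" by auto
    then show ?thesis using increasing_uminus[OF I0] by (metis card_image inj_uminus inj_on_subset subset_UNIV)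
  qed (use I0 in blast)
  then obtain I where I: "increasing I" "card I = card I0" "- p \<notin> I" by blast
  have Ipos: "I \<subseteq> positions" and Iinc: "\<And>x y. x \<in> I \<Longrightarrow> y \<in> I \<Longrightarrow> x < y \<Longrightarrow> f x < f y"
    using I by (auto simp: increasing_def)
  \<comment> \<open>\<open>A\<close> mirrors the negative half of \<open>I\<close>, and
    \<open>C\<close> is the positive half without \<open>p\<close>. Both consist of positive
    positions with positive values, so both can be symmetrized.\<close>
  define A where "A = uminus ` (I \<inter> {..<0})"
  define C where "C = (I \<inter> {0<..}) - {p}"
  have cardA: "card A = card (I \<inter> {..<0})" unfolding A_def by (simp add: card_image)
  have incC: "increasing C" using I(1) by (auto simp: C_def increasing_def)
  have "increasing (I \<inter> {..<0})" using I(1) by (auto simp: increasing_def)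
  then have incA: "increasing A" unfolding A_def by (rule increasing_uminus)
  have Cpos: "0 < c \<and> 0 < f c \<and> c \<noteq> p \<and> c \<in> I" if "c \<in> C" for c
    using pivot_unique[OF nb pv, of c] that Ipos by (auto simp: C_def positions_def)
  have Apos: "0 < a \<and> 0 < f a \<and> a \<noteq> p \<and> - a \<in> I" if "a \<in> A" for a
  proof -
    have a: "0 < a" "- a \<in> I" using that by (auto simp: A_def)
    then have "a \<noteq> p" "a \<le> int n" using I(3) Ipos by (auto simp: positions_def)
    then show ?thesis using pivot_unique[OF nb pv a(1)] a by simp
  qed
  have A2: "2 * card A \<le> card I" using mx increasing_symmetrize[OF incA] Apos I(2) by metis
  have C2: "2 * card C \<le> card I" using mx increasing_symmetrize[OF incC] Cpos I(2) by metis
  have fin: "finite I" "finite C" "finite A" using increasing_finite I incA incC by auto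
  have un: "I \<inter> {..<0} \<union> I \<inter> {0<..} = I" using Ipos by (force simp: positions_def)
  have cardI: "card I = card A + card (I \<inter> {0<..})"
    using card_Un_disjoint[of "I \<inter> {..<0}" "I \<inter> {0<..}"] fin un cardA by force
  show ?thesis
  proof (cases "p \<in> I")
    case False
    then have "card I = card A + card C" using cardI by (simp add: C_def)
    \<comment> \<open>The two halves add up to \<open>card I\<close>, and neither exceeds half of
      it.\<close>
    then have "card I = 2 * card C" using A2 C2 by linarith
    then show ?thesis using I by simp
  next
    case True
    then have "I \<inter> {0<..} = insert p C" using p by (auto simp: C_def)
    moreover have "p \<notin> C" by (simp add: C_def)
    ultimately have cardI': "card I = card A + card C + 1" using cardI fin(2) by simp
    \<comment> \<open>\<open>f p < 0 < f c\<close> puts \<open>c\<close> to the right of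
      \<open>p\<close>, and \<open>f c < f j\<close> would make \<open>- p, j, c\<close> a
      triple.\<close>
    have jC: "j < c \<and> f j < f c" if "c \<in> C" for c
    proof -
      have c: "0 < c" "0 < f c" "c \<noteq> p" "c \<in> I" using Cpos[OF that] by auto
      have "p < c" using Iinc[of c p] c True p by linarith
      moreover have "f j < f c"
      proof (rule ccontr)
        assume "\<not> ?thesis"
        moreover have "f j \<noteq> f c" using inj[of j c] p c Ipos \<open>p < c\<close> by (auto simp: positions_def)
        ultimately have "triple n f (- p) j c" using p c Ipos \<open>p < c\<close>
          by (auto simp: triple_def odd positions_def)
        then show False using nb by (auto simp: bad_def)
      qed
      ultimately show ?thesis using p by auto
    qed
    \<comment> \<open>From \<open>- a < p\<close> in \<open>I\<close> follows
      \<open>f a > - f p > f j\<close>, and then \<open>a < j\<close> would make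
      \<open>a, j, p\<close> a triple.\<close>
    have jA: "j < a \<and> f j < f a" if "a \<in> A" for a
    proof -
      have a: "0 < a" "0 < f a" "a \<noteq> p" "- a \<in> I" using Apos[OF that] by auto
      have "f (- a) < f p" using Iinc[OF a(4) True] a p by linarith
      then have ja: "f j < f a" using p odd[of a] by linarith
      moreover have "j < a"
      proof (rule ccontr)
        assume "\<not> ?thesis"
        moreover have "a \<noteq> j" using ja by auto
        ultimately have "triple n f a j p" using p a ja Ipos by (auto simp: triple_def positions_def)
        then show False using nb by (auto simp: bad_def)
      qed
      ultimately show ?thesis by simp
    qed
    have two: "2 * (card K + 1) \<le> card I"
      if K: "increasing K" "\<And>k. k \<in> K \<Longrightarrow> 0 < k \<and> 0 < f k" "\<And>k. k \<in> K \<Longrightarrow> j < k \<and> f j < f k" for K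
    proof -
      have "increasing (insert j K)"
        using K(1) jp K(3) unfolding increasing_def by (auto dest: less_asym)
      moreover have "0 < k \<and> 0 < f k" if "k \<in> insert j K" for k using that K(2) p by auto
      ultimately have "2 * card (insert j K) \<le> card I"
        using increasing_symmetrize[of "insert j K"] mx I(2) by metis
      moreover have "j \<notin> K" using K(3) by blast
      ultimately show ?thesis using increasing_finite[OF K(1)] by simp
    qed
    have "2 * (card A + 1) \<le> card I" by (rule two[OF incA]) (use Apos jA in auto)
    moreover have "2 * (card C + 1) \<le> card I" by (rule two[OF incC]) (use Cpos jC in auto)
    \<comment> \<open>Together with \<open>card I = card A + card C + 1\<close> the two bounds
      contradict each other, so this case does not occur.\<close>
    ultimately have "card A + 1 \<le> card C" "card C + 1 \<le> card A" using cardI' by simp_all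
    then show ?thesis by simp
  qed
qed

end

section \<open>Shapes\<close>

lemma inc_on_map:
  "sorted_wrt (<) ps \<Longrightarrow> inc_on (map f ps) A \<longleftrightarrow>
     (\<forall>p\<in>set ps. \<forall>q\<in>set ps. p < q \<longrightarrow> f p \<in> A \<longrightarrow> f q \<in> A \<longrightarrow> f p < f q)"
  for ps :: "int list"
proof (induction ps)
  case (Cons p ps)
  then show ?case by (auto dest: less_asym)
qed simp

lemma w0_seq_map:
  assumes "length w = n"
  shows "w0_seq w = map (val w) ([- int n..- 1] @ [1..int n])"
proof -
  have "map (val w) [1..int n] = w"
    using assms by (intro nth_equalityI) (simp_all add: nth_upto val_def nat_add_distrib)
  moreover have "map (val w) [- int n..- 1] = map uminus (rev w)"
  proof (rule nth_equalityI)
    fix k assume "k < length (map (val w) [- int n..- 1])"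
    then have k: "k < n" by simp
    then have "nat (int n - int k) - 1 = n - Suc k" by linarith
    then show "map (val w) [- int n..- 1] ! k = map uminus (rev w) ! k"
      using k assms by (simp add: nth_upto val_def rev_nth)
  qed (use assms in simp)
  ultimately show ?thesis by (simp add: w0_seq_def)
qed

context
  fixes n :: nat and w :: "int list"
  assumes w: "signed_perm n w"
begin

interpretation signed_map n "val w"
  by (rule signed_map_val[OF w])

lemma w0_positions:
  obtains ps where "w0_seq w = map (val w) ps" "sorted_wrt (<) ps" "set ps = positions"
proof
  let ?ps = "[- int n..- 1] @ [1..int n]"
  show "w0_seq w = map (val w) ?ps" using w0_seq_map signed_perm_length[OF w] by blast
  show "sorted_wrt (<) ?ps" by (simp add: sorted_wrt_append)
  show "set ?ps = positions" by (auto simp: positions_def)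
qed

lemma distinct_w0_seq: "distinct (w0_seq w)"
proof -
  obtain ps where ps: "w0_seq w = map (val w) ps" "sorted_wrt (<) ps" "set ps = positions"
    by (rule w0_positions)
  then show ?thesis using inj_on_positions by (simp add: distinct_map strict_sorted_iff)
qed

lemma length_w0_seq: "length (w0_seq w) = 2 * n"
  using signed_perm_length[OF w] by (simp add: w0_seq_def)

lemma chain_image:
  assumes I: "increasing I"
  shows "chain (w0_seq w) (val w ` I)" "card (val w ` I) = card I"
proof -
  obtain ps where ps: "w0_seq w = map (val w) ps" "sorted_wrt (<) ps" "set ps = positions"
    by (rule w0_positions)
  have IP: "I \<subseteq> positions" using I by (simp add: increasing_def)
  have mem: "p \<in> I" if "p \<in> positions" "val w p \<in> val w ` I" for p
    using that IP inj_on_image_mem_iff[OF inj_on_positions] by blast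
  have "val w p < val w q"
    if "p \<in> positions" "q \<in> positions" "p < q" "val w p \<in> val w ` I" "val w q \<in> val w ` I" for p q
    using mem[OF that(1,4)] mem[OF that(2,5)] that(3) I unfolding increasing_def by blast
  then have "inc_on (w0_seq w) (val w ` I)"
    unfolding ps(1) inc_on_map[OF ps(2)] ps(3) by blast
  moreover have "val w ` I \<subseteq> set (w0_seq w)" using IP unfolding ps(1) set_map ps(3) by blast
  ultimately show "chain (w0_seq w) (val w ` I)" by (simp add: chain_def)
  show "card (val w ` I) = card I"
    by (rule card_image[OF inj_on_subset[OF inj_on_positions IP]])
qed

lemma chain_preimage:
  assumes A: "chain (w0_seq w) A"
  obtains I where "increasing I" "val w ` I = A"
proof
  obtain ps where ps: "w0_seq w = map (val w) ps" "sorted_wrt (<) ps" "set ps = positions"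
    by (rule w0_positions)
  show "increasing (positions \<inter> val w -` A)"
    using A unfolding chain_def ps(1) inc_on_map[OF ps(2)] ps(3) increasing_def by blast
  show "val w ` (positions \<inter> val w -` A) = A"
    using A unfolding chain_def ps(1) set_map ps(3) by blast
qed

lemma card_image_positions: "I \<subseteq> positions \<Longrightarrow> card (val w ` I) = card I"
  using card_image inj_on_subset[OF inj_on_positions] by blast

lemma two_rows_bad:
  assumes "bad n (val w)" shows "sum_list (take 2 (lam w)) + 1 < 2 * n"
proof -
  obtain A B where AB: "chain (w0_seq w) A" "chain (w0_seq w) B"
    "card (A \<union> B) = sum_list (take 2 (lam w))"
    using ex_chains_rows[OF distinct_w0_seq] unfolding lam_def by blast
  obtain I where I: "increasing I" "val w ` I = A" using chain_preimage[OF AB(1)] .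
  obtain J where J: "increasing J" "val w ` J = B" using chain_preimage[OF AB(2)] .
  have "card (A \<union> B) = card (I \<union> J)"
    using card_image_positions[of "I \<union> J"] I J by (simp add: increasing_def image_Un)
  then show ?thesis using bad_no_cover[OF assms I(1) J(1)] AB(3) by simp
qed

lemma two_rows_cover:
  assumes "increasing I" "increasing J"
  shows "card (I \<union> J) \<le> sum_list (take 2 (lam w))"
proof -
  have "card (val w ` I \<union> val w ` J) \<le> sum_list (take 2 (lam w))"
    using chains_le_rows[OF distinct_w0_seq] chain_image assms unfolding lam_def by blast
  moreover have "card (val w ` (I \<union> J)) = card (I \<union> J)"
    using card_image_positions[of "I \<union> J"] assms by (simp add: increasing_def)
  ultimately show ?thesis by (simp add: image_Un)
qed

lemma even_first_row:
  assumes "\<not> bad n (val w)" "pivot p j"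
  shows "even (sum_list (take 1 (lam w)))"
proof -
  obtain A where A: "chain (w0_seq w) A" "card A = sum_list (take 1 (lam w))"
    using ex_chain_row[OF distinct_w0_seq] unfolding lam_def by blast
  obtain I where I: "increasing I" "val w ` I = A" using chain_preimage[OF A(1)] .
  have c: "card I = sum_list (take 1 (lam w))" using chain_image(2)[OF I(1)] I(2) A(2) by simp
  have "card K \<le> card I" if "increasing K" for K
    using chain_le_row[OF distinct_w0_seq chain_image(1)[OF that]] chain_image(2)[OF that] c
    unfolding lam_def by simp
  then show ?thesis using even_maximal[OF assms I(1)] c by simp
qed

lemma not_bad_rows:
  assumes "\<not> bad n (val w)"
  shows "sum_list (take 2 (lam w)) = 2 * n \<or>
    sum_list (take 2 (lam w)) + 1 = 2 * n \<and> even (sum_list (take 1 (lam w)))"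
proof -
  have "sum_list (take 2 (lam w)) \<le> sum_list (lam w)"
    by (metis append_take_drop_id le_add1 sum_list_append)
  then have le: "sum_list (take 2 (lam w)) \<le> 2 * n"
    using sum_rsk_shape[OF distinct_w0_seq] length_w0_seq by (simp add: lam_def)
  from not_bad_cover[OF assms] show ?thesis
  proof (elim disjE exE conjE)
    fix I J assume IJ: "increasing I" "increasing J" "card (I \<union> J) = 2 * n"
    then show ?thesis using two_rows_cover[OF IJ(1,2)] le by simp
  next
    fix p j I J assume "pivot p j" and IJ: "increasing I" "increasing J" "card (I \<union> J) + 1 = 2 * n"
    then have "even (sum_list (take 1 (lam w)))" using even_first_row[OF assms] by blast
    then show ?thesis using two_rows_cover[OF IJ(1,2)] le IJ(3) by linarith
  qed
qed

end

section \<open>Arithmetic of admissible shapes\<close>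

lemma admissible_two_rows:
  assumes "admissible n l" shows "2 * n \<le> sum_list (take 2 l) + 1"
proof -
  have "sum_list (take 2 l) = 2 * n" if "k \<le> n" "l = filter (\<lambda>x. 0 < x) [2 * n - k, k]" for k
    using that by auto
  moreover have "2 * n \<le> sum_list (take 2 l) + 1"
    if "1 \<le> k" "k \<le> n div 2" "l = [2 * n - 2 * k, 2 * k - 1, 1]" for k
    using that by auto
  ultimately show ?thesis using assms unfolding admissible_def by fastforce
qed

lemma admissibleI:
  assumes n: "1 \<le> n" and l: "sum_list l = 2 * n" "sorted_wrt (\<ge>) l" "\<forall>x\<in>set l. 0 < x"
    and r: "sum_list (take 2 l) = 2 * n \<or> sum_list (take 2 l) + 1 = 2 * n \<and> even (sum_list (take 1 l))"
  shows "admissible n l"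
proof -
  consider "l = []" | a where "l = [a]" | a b where "l = [a, b]" | a b c m where "l = a # b # c # m"
    by (metis neq_Nil_conv)
  then show ?thesis
  proof cases
    case 1 then show ?thesis using n l by simp
  next
    case 2
    \<comment> \<open>A single row is the two-row shape with \<open>k = 0\<close>, whose zero part
      the filter removes.\<close>
    then have "l = filter (\<lambda>x. 0 < x) [2 * n - 0, 0]" using n l by simp
    then show ?thesis unfolding admissible_def by blast
  next
    case (3 a b)
    then have "b \<le> n" "l = filter (\<lambda>x. 0 < x) [2 * n - b, b]" using l by auto
    then show ?thesis unfolding admissible_def by blast
  next
    case (4 a b c m)
    then have ab: "a + b + (c + sum_list m) = 2 * n" "0 < c" "0 < b" "b \<le> a" using l by auto
    then have *: "a + b + 1 = 2 * n" "even a" "c + sum_list m = 1" using r 4 by auto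
    then have "c = 1" "sum_list m = 0" using ab by linarith+
    moreover have "m = []" using \<open>sum_list m = 0\<close> l(3) 4 by (cases m) auto
    \<comment> \<open>Chosen so that \<open>a = 2 * n - 2 * k\<close>; the total then gives
      \<open>b = 2 * k - 1\<close>. From \<open>0 < b\<close> follows \<open>1 \<le> k\<close>, and
      from \<open>b \<le> a\<close> follows \<open>k \<le> n div 2\<close>.\<close>
    moreover define k where "k = n - a div 2"
    moreover have "a = 2 * (a div 2)" using * by simp
    ultimately have "l = [2 * n - 2 * k, 2 * k - 1, 1]" "1 \<le> k" "k \<le> n div 2"
      using 4 * ab by auto
    then show ?thesis unfolding admissible_def by blast
  qed
qed

theorem mainTheorem6:
  fixes n :: nat and w :: "int list"
  assumes "1 \<le> n" and "signed_perm n w"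
  shows "fully_commutative n w \<longleftrightarrow> admissible n (lam w)"
proof -
  note d = distinct_w0_seq[OF assms(2)]
  have "admissible n (lam w) \<longleftrightarrow> \<not> bad n (val w)"
  proof
    assume "admissible n (lam w)"
    then show "\<not> bad n (val w)" using admissible_two_rows two_rows_bad[OF assms(2)] by fastforce
  next
    assume "\<not> bad n (val w)"
    then show "admissible n (lam w)"
      using admissibleI[OF assms(1)] not_bad_rows[OF assms(2)] sum_rsk_shape[OF d]
        sorted_rsk_shape[OF d] rsk_shape_pos[OF d] length_w0_seq[OF assms(2)]
      unfolding lam_def by metis
  qed
  then show ?thesis using fully_commutative_iff_not_bad[OF assms(2)] by simp
qed

end
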